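(* Let $d\ge1$ and let $Y_{m,\ell}$ denote the spherical harmonics on $\mathbb{S}^d$. Let $\{(m_\alpha,\ell_\alpha)\}$ be a fixed, finite set of parameters. Then there exists a solution $\phi$ of the linear equation $$\Box_{\mathcal{M}_{\mathrm{dS}}}\phi+(d+1)\phi=0$$ satisfying $$\|\phi(t,\cdot)\|_{L^\infty(\mathbb{S}^d)}\gtrsim t$$ for all sufficiently large $t$, and such that $$\int_{\mathbb{S}^d}\phi(t,\omega)\,Y_{m_\alpha,\ell_\alpha}(\omega)\,d\omega=0$$ for all parameters $(m_\alpha,\ell_\alpha)$ belonging to the fixed finite set.
   Context: $\mathcal{M}_{\mathrm{dS}}=\{x\in\mathbb{R}^{1,d+1}:-(x^0)^2+\sum_{i=1}^{d+1}(x^i)^2=1\}$ with the induced Lorentzian metric. With $t=x^0$, $\omega\in\mathbb{S}^d$, $\langle t\rangle=\sqrt{1+t^2}$, the metric is $-\langle t\rangle^{-2}dt^2+\langle t\rangle^2d\omega^2$ and $$\Box_{\mathcal{M}_{\mathrm{dS}}}\phi=-\langle t\rangle^{-(d-1)}\partial_t\big(\langle t\rangle^{d+1}\partial_t\phi\big)+\langle t\rangle^{-2}\Delta_{\mathbb{S}^d}\phi .$$ The equation is the linearisation at $\phi=0$ of the condition that the graph $\{x+\phi(x)\vec n\}$ over $\mathcal{M}_{\mathrm{dS}}$ have constant mean curvature $d+1$. $A\gtrsim B$ means $A\ge cB$ for some constant $c>0$ (independent of $t$). Spherical harmonics are indexed by degree $\ell$ and, within each degree, by $m$. *)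

theory Defs
  imports "HOL-Analysis.Analysis" "HOL-Probability.Essential_Supremum"
begin

text \<open>
  Throughout, \<open>'a\<close> is the Euclidean space containing the unit sphere, so that
  the dimension of the sphere is \<open>d = DIM('a) - 1\<close>, and Minkowski space is
  \<open>real \<times> 'a\<close>, the first component being the time coordinate.
\<close>

primrec Ck_on :: "nat \<Rightarrow> ('b::euclidean_space \<Rightarrow> real) \<Rightarrow> 'b set \<Rightarrow> bool" where
  "Ck_on 0 g U \<longleftrightarrow> continuous_on U g"
| "Ck_on (Suc k) g U \<longleftrightarrow> g differentiable_on U \<and>
     (\<forall>b\<in>Basis. Ck_on k (\<lambda>x. frechet_derivative g (at x) b) U)"

text \<open>Smoothness on an embedded submanifold: there is a smooth extension to an open
  neighbourhood. (\<^const>\<open>Ck_on\<close> is meant for open sets only.)\<close>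

definition smooth_on_submanifold :: "('b::euclidean_space \<Rightarrow> real) \<Rightarrow> 'b set \<Rightarrow> bool" where
  "smooth_on_submanifold \<phi> M \<longleftrightarrow>
     (\<exists>U g. open U \<and> M \<subseteq> U \<and> (\<forall>x\<in>M. g x = \<phi> x) \<and> (\<forall>k. Ck_on k g U))"

definition laplacian :: "('a::euclidean_space \<Rightarrow> 'b::real_normed_vector) \<Rightarrow> 'a \<Rightarrow> 'b" where
  "laplacian g x = (\<Sum>b\<in>Basis. vector_derivative
     (\<lambda>s. vector_derivative (\<lambda>r. g (x + r *\<^sub>R b)) (at s)) (at 0))"

text \<open>The Laplace--Beltrami operator of the unit sphere: the Euclidean Laplacian of the
  extension \<open>x \<mapsto> f (x / norm x)\<close>, which is homogeneous of degree 0. Only the values of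
  \<open>f\<close> on the sphere enter.\<close>

definition sphere_laplacian :: "('a::euclidean_space \<Rightarrow> real) \<Rightarrow> 'a \<Rightarrow> real" where
  "sphere_laplacian f \<omega> = laplacian (\<lambda>x. f (sgn x)) \<omega>"

text \<open>The surface measure, as the cone measure: the measure of \<open>A\<close> is \<open>DIM('a)\<close> times the
  volume of the cone \<open>{r *\<^sub>R \<omega> | 0 < r < 1, \<omega> \<in> A}\<close>.\<close>

definition sphere_measure :: "'a::euclidean_space measure" where
  "sphere_measure =
     distr (scale_measure (of_nat DIM('a)) (restrict_space lborel (ball 0 1 - {0})))
       (restrict_space borel (sphere 0 1)) sgn"

text \<open>Spherical harmonics are taken complex valued; real spherical harmonics are a special case.\<close>

definition spherical_harmonic :: "nat \<Rightarrow> ('a::euclidean_space \<Rightarrow> complex) \<Rightarrow> bool" where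
  "spherical_harmonic l Z \<longleftrightarrow>
     (\<exists>p. polynomial_function p \<and> (\<forall>c x. p (c *\<^sub>R x) = c ^ l *\<^sub>R p x) \<and>
          (\<forall>x. laplacian p x = 0) \<and> (\<forall>\<omega>\<in>sphere 0 1. Z \<omega> = p \<omega>))"

text \<open>\<open>Y m l\<close>, for \<open>m\<close> in the finite index set \<open>M l\<close>, is an \<open>L\<^sup>2\<close>-orthonormal basis of the
  space of spherical harmonics of degree \<open>l\<close>, for every \<open>l\<close>.\<close>

definition spherical_harmonic_basis ::
    "(nat \<Rightarrow> 'm set) \<Rightarrow> ('m \<Rightarrow> nat \<Rightarrow> 'a::euclidean_space \<Rightarrow> complex) \<Rightarrow> bool" where
  "spherical_harmonic_basis M Y \<longleftrightarrow>
     (\<forall>l. finite (M l) \<and>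
        (\<forall>m\<in>M l. spherical_harmonic l (Y m l)) \<and>
        (\<forall>m\<in>M l. \<forall>m'\<in>M l.
           (LINT \<omega>|sphere_measure. Y m l \<omega> * cnj (Y m' l \<omega>)) = (if m = m' then 1 else 0)) \<and>
        (\<forall>Z. spherical_harmonic l Z \<longrightarrow>
           (\<exists>c. \<forall>\<omega>\<in>sphere 0 1. Z \<omega> = (\<Sum>m\<in>M l. c m * Y m l \<omega>))))"

definition de_sitter :: "(real \<times> 'a::euclidean_space) set" where
  "de_sitter = {(t, y). - t\<^sup>2 + (\<Sum>b\<in>Basis. (y \<bullet> b)\<^sup>2) = 1}"

definition bracket :: "real \<Rightarrow> real" where
  "bracket t = sqrt (1 + t\<^sup>2)"

definition dS_point :: "real \<Rightarrow> 'a::euclidean_space \<Rightarrow> real \<times> 'a" where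
  "dS_point t \<omega> = (t, bracket t *\<^sub>R \<omega>)"

lemma bij_betw_dS_point:
  "bij_betw (\<lambda>(t, \<omega>). dS_point t \<omega>) (UNIV \<times> sphere 0 1) (de_sitter :: (real \<times> 'a::euclidean_space) set)"
proof (rule bij_betwI[where g = "\<lambda>(t, y). (t, y /\<^sub>R bracket t)"])
  have pos: "bracket t > 0" and sq: "(bracket t)\<^sup>2 = 1 + t\<^sup>2" for t
    by (auto simp: bracket_def add_pos_nonneg)
  have nrm: "(\<Sum>b\<in>Basis. (y \<bullet> b)\<^sup>2) = (norm y)\<^sup>2" for y :: 'a
    by (simp add: norm_eq_sqrt_inner euclidean_inner[of y y] power2_eq_square sum_nonneg)
  show "(\<lambda>(t, \<omega>). dS_point t \<omega>) \<in> UNIV \<times> sphere 0 1 \<rightarrow> (de_sitter :: (real \<times> 'a) set)"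
    by (auto simp: dS_point_def de_sitter_def nrm power_mult_distrib sq)
  have "norm (y /\<^sub>R bracket t) = 1" if "(norm y)\<^sup>2 - t\<^sup>2 = 1" for t and y :: 'a
  proof -
    have "(norm y)\<^sup>2 = (bracket t)\<^sup>2" using that by (simp add: sq)
    then have "norm y = bracket t" using pos[of t] by (simp add: power2_eq_iff_nonneg)
    then show ?thesis using pos[of t] by simp
  qed
  then show "(\<lambda>(t, y). (t, y /\<^sub>R bracket t)) \<in> (de_sitter :: (real \<times> 'a) set) \<rightarrow> UNIV \<times> sphere 0 1"
    by (auto simp: de_sitter_def nrm)
  have "bracket t \<noteq> 0" for t using pos[of t] by simp
  then show "(\<lambda>(t, y). (t, y /\<^sub>R bracket t)) ((\<lambda>(t, \<omega>). dS_point t \<omega>) x) = x"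
    and "(\<lambda>(t, \<omega>). dS_point t \<omega>) ((\<lambda>(t, y). (t, y /\<^sub>R bracket t)) z) = z"
    for x z :: "real \<times> 'a"
    by (auto simp: dS_point_def split: prod.splits)
qed

text \<open>The d'Alembertian of the induced metric
  \<open>- bracket t ^ (-2) * dt\<^sup>2 + (bracket t)\<^sup>2 * d\<omega>\<^sup>2\<close>, applied to a function \<open>\<phi>\<close> on de Sitter
  space and expressed in the global coordinates \<open>(t, \<omega>)\<close> given by \<^const>\<open>dS_point\<close>.\<close>

definition dS_box :: "(real \<times> 'a::euclidean_space \<Rightarrow> real) \<Rightarrow> real \<Rightarrow> 'a \<Rightarrow> real" where
  "dS_box \<phi> t \<omega> = (let d = DIM('a) - 1; u = (\<lambda>s \<eta>. \<phi> (dS_point s \<eta>)) in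
     - (bracket t powi (- (int d - 1)) *
          deriv (\<lambda>s. bracket s ^ (d + 1) * deriv (\<lambda>r. u r \<omega>) s) t)
     + bracket t powi (-2) * sphere_laplacian (u t) \<omega>)"

end

theory Submission
  imports Defs "HOL-Real_Asymp.Real_Asymp"
begin

text \<open>
  Separate variables. Fix two coordinates of the sphere, combine them into the complex
  coordinate \<open>\<zeta>\<close>, and look for solutions \<open>\<phi>(t, \<omega>) = a(t) Re (\<zeta>(\<omega>)^n)\<close>; the function
  \<open>Re (\<zeta>^n)\<close> is a spherical harmonic of degree \<open>n\<close>. For large \<open>t\<close> the term of the equation that
  contains the degree is negligible, and what remains is the Euler equation
  \<open>t\<^sup>2 a'' + (d + 1) t a' = (d + 1) a\<close> with the solutions \<open>t\<close> and \<open>t^(-d-1)\<close>. So every degree has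
  a solution that grows linearly, and a finite set of harmonics can be avoided by taking \<open>n\<close> large.

  An explicit growing solution comes from the substitutions \<open>a(t) = bracket t * F(w)\<close> and
  \<open>w = t\<^sup>2 / (1 + t\<^sup>2)\<close>, which turn the equation for \<open>a\<close> into Gauss's equation for
  \<open>F = 2F1(- (n + d) / 2, (n - 1) / 2; 1/2; w)\<close>. As \<open>t\<close> tends to infinity \<open>w\<close> tends to \<open>1\<close>, and
  everything hinges on \<open>F(1) \<noteq> 0\<close>. Gauss's formula gives
  \<open>F(1) = \<Gamma>(1/2) \<Gamma>(1 + d/2) / (\<Gamma>((1 + n + d) / 2) \<Gamma>(1 - n/2))\<close>, which vanishes for
  even \<open>n \<ge> 2\<close> but not for odd \<open>n\<close>. Hence \<open>n = 2 q + 1\<close> is chosen odd. Then the second parameter is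
  the natural number \<open>q\<close>, and \<open>F(1) \<noteq> 0\<close> already follows from one contiguous relation
  by induction on \<open>q\<close> (\<open>hyp2F1_at_1_nonzero\<close>). Oddness also removes all square roots:
  \<open>Re (\<zeta>(y)^n) (1 + t\<^sup>2)^(-q) F(w)\<close> is a smooth extension of the solution to all of Minkowski space.

  Orthogonality to the given harmonics comes from rotations. A rotation of the chosen
  plane by the angle \<open>\<theta>\<close> preserves the surface measure and multiplies \<open>\<zeta>\<close> by \<open>cis \<theta>\<close>. A polynomial
  is a finite sum of functions on which these rotations act by \<open>cis (k * \<theta>)\<close>, so once \<open>n\<close> exceeds
  every \<open>\<bar>k\<bar>\<close> that occurs, its products with \<open>\<zeta>^n\<close> and with the conjugate power have
  no invariant part and integrate to zero (\<open>rot_finite_orthogonal\<close>).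
\<close>

section \<open>Invariance of the surface measure under linear isometries\<close>

lemma nn_integral_lborel_shift:
  fixes f :: "'a::euclidean_space \<Rightarrow> ennreal"
  assumes [measurable]: "f \<in> borel_measurable borel"
  shows "(\<integral>\<^sup>+x. f (c + x) \<partial>lborel) = (\<integral>\<^sup>+x. f x \<partial>lborel)"
  by (subst (2) lborel_distr_plus[symmetric, of c]) (simp add: nn_integral_distr)

lemma emeasure_lborel_open_pos:
  assumes "open (U :: 'a::euclidean_space set)" and "U \<noteq> {}"
  shows "emeasure lborel U > 0"
proof -
  have "U \<in> sets borel" using assms by simp
  moreover have "\<not> negligible U" using open_not_negligible assms by blast
  ultimately have "emeasure lborel U \<noteq> 0"
    by (auto simp: negligible_iff_null_sets null_sets_def)
  then show ?thesis by (simp add: zero_less_iff_neq_zero)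
qed

text \<open>
  The integrals of \<open>f\<close> and \<open>f \<circ> R\<close> are compared after multiplication by the volume \<open>V\<close> of the
  unit ball: write \<open>V\<close> as the integral of the indicator of the ball in a second variable and shear
  the product, \<open>(x, y) \<mapsto> (x, y + R x)\<close>. Translation invariance in each variable and Fubini turn
  one product into the other, because the ball is invariant under \<open>R\<close>.
\<close>

lemma lborel_distr_linear_isometry:
  fixes R :: "'a::euclidean_space \<Rightarrow> 'a"
  assumes lin: "linear R" and iso: "\<And>x. norm (R x) = norm x"
  shows "distr lborel borel R = lborel"
proof -
  have [measurable]: "R \<in> borel_measurable borel"
    using lin by (intro borel_measurable_continuous_onI linear_continuous_on linear_conv_bounded_linear[THEN iffD1])
  have "inj R"
    using lin iso by (metis linear_injective_0 norm_eq_zero)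
  then have surj: "surj R" using lin linear_injective_imp_surjective by blast
  have main: "(\<integral>\<^sup>+x. f (R x) \<partial>lborel) = (\<integral>\<^sup>+x. f x \<partial>lborel)"
    if [measurable]: "f \<in> borel_measurable borel" for f :: "'a \<Rightarrow> ennreal"
  proof -
    let ?g = "indicator (ball 0 1) :: 'a \<Rightarrow> ennreal"
    have [measurable]: "?g \<in> borel_measurable borel" by (intro borel_measurable_indicator) auto
    define V where "V = emeasure lborel (ball 0 1 :: 'a set)"
    have V: "V \<noteq> 0" "V \<noteq> \<infinity>"
      using emeasure_lborel_open_pos[of "ball 0 1 :: 'a set"] emeasure_lborel_ball_finite[of "0::'a" 1]
      unfolding V_def by (auto simp: infinity_ennreal_def)
    \<comment> \<open>The set of \<open>x\<close> with \<open>y - R x\<close> in the ball is a translated ball, centred at the preimage of \<open>y\<close>.\<close>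
    have slice: "(\<integral>\<^sup>+x. ?g (y - R x) \<partial>lborel) = V" for y
    proof -
      obtain w where w: "R w = y" using surj by (metis surjD)
      have "?g (y - R x) = ?g ((- w) + x)" for x
      proof -
        have "norm (y - R x) = norm (x - w)"
          using iso[of "w - x"] lin by (simp add: linear_diff w norm_minus_commute)
        then show ?thesis by (simp add: indicator_def add.commute)
      qed
      then have "(\<integral>\<^sup>+x. ?g (y - R x) \<partial>lborel) = (\<integral>\<^sup>+x. ?g ((- w) + x) \<partial>lborel)" by simp
      also have "\<dots> = V" by (subst nn_integral_lborel_shift) (auto simp: V_def intro!: borel_measurable_indicator)
      finally show ?thesis .
    qed
    have shift: "(\<integral>\<^sup>+x. f (y + R x) \<partial>lborel) = (\<integral>\<^sup>+x. f (R x) \<partial>lborel)" for y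
    proof -
      obtain w where w: "R w = y" using surj by (metis surjD)
      have "f (y + R x) = f (R (w + x))" for x using lin w by (simp add: linear_add)
      then show ?thesis
        using nn_integral_lborel_shift[of "\<lambda>x. f (R x)" w] by simp
    qed
    have "V * (\<integral>\<^sup>+x. f (R x) \<partial>lborel) = (\<integral>\<^sup>+y. ?g y * (\<integral>\<^sup>+x. f (R x) \<partial>lborel) \<partial>lborel)"
      by (simp add: nn_integral_multc V_def)
    also have "\<dots> = (\<integral>\<^sup>+y. (\<integral>\<^sup>+x. ?g y * f (y + R x) \<partial>lborel) \<partial>lborel)"
      by (simp add: nn_integral_cmult shift)
    also have "\<dots> = (\<integral>\<^sup>+x. (\<integral>\<^sup>+y. ?g y * f (y + R x) \<partial>lborel) \<partial>lborel)"
      by (rule lborel_pair.Fubini') simp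
    also have "\<dots> = (\<integral>\<^sup>+x. (\<integral>\<^sup>+y. ?g (y - R x) * f y \<partial>lborel) \<partial>lborel)"
    proof (rule nn_integral_cong)
      fix x
      show "(\<integral>\<^sup>+y. ?g y * f (y + R x) \<partial>lborel) = (\<integral>\<^sup>+y. ?g (y - R x) * f y \<partial>lborel)"
        using nn_integral_lborel_shift[of "\<lambda>y. ?g (y - R x) * f y" "R x"] by (simp add: add.commute)
    qed
    also have "\<dots> = (\<integral>\<^sup>+y. (\<integral>\<^sup>+x. ?g (y - R x) * f y \<partial>lborel) \<partial>lborel)"
      by (rule lborel_pair.Fubini') simp
    also have "\<dots> = (\<integral>\<^sup>+y. V * f y \<partial>lborel)"
      by (simp add: nn_integral_multc slice)
    also have "\<dots> = V * (\<integral>\<^sup>+y. f y \<partial>lborel)"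
      by (simp add: nn_integral_cmult)
    finally show ?thesis using V by (simp add: ennreal_mult_cancel_left)
  qed
  show ?thesis
  proof (rule measure_eqI)
    fix A assume "A \<in> sets (distr lborel borel R)"
    then have [measurable]: "A \<in> sets borel" by simp
    have "emeasure (distr lborel borel R) A = (\<integral>\<^sup>+x. indicator A x \<partial>distr lborel borel R)" by simp
    also have "\<dots> = (\<integral>\<^sup>+x. indicator A (R x) \<partial>lborel)" by (subst nn_integral_distr) auto
    also have "\<dots> = emeasure lborel A" by (subst main) auto
    finally show "emeasure (distr lborel borel R) A = emeasure lborel A" .
  qed simp
qed

lemma measurable_sgn_borel [measurable]: "(sgn :: 'a::euclidean_space \<Rightarrow> 'a) \<in> borel_measurable borel"
  unfolding sgn_div_norm[abs_def] by measurable

lemma space_sphere_measure [simp]: "space sphere_measure = sphere (0::'a::euclidean_space) 1"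
  by (simp add: sphere_measure_def)

lemma sets_sphere_measure [simp, measurable_cong]:
  "sets (sphere_measure :: 'a::euclidean_space measure) = sets (restrict_space borel (sphere 0 1))"
  by (simp add: sphere_measure_def)

lemma emeasure_sphere_measure:
  fixes A :: "'a::euclidean_space set"
  assumes A: "A \<in> sets borel" "A \<subseteq> sphere 0 1"
  shows "emeasure sphere_measure A = of_nat DIM('a) * emeasure lborel {x \<in> ball 0 1 - {0}. sgn x \<in> A}"
proof -
  let ?D = "ball 0 1 - {0} :: 'a set"
  have m: "sgn \<in> restrict_space lborel ?D \<rightarrow>\<^sub>M restrict_space borel (sphere 0 1)"
    by (rule measurable_restrict_space2)
       (auto simp: norm_sgn space_restrict_space intro!: measurable_restrict_space1)
  have A': "A \<in> sets (restrict_space borel (sphere 0 1))"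
    using A by (simp add: sets_restrict_space_iff)
  have "sgn -` A \<inter> ?D \<in> sets borel"
    using measurable_sets[OF measurable_sgn_borel A(1)] by simp
  then have "emeasure sphere_measure A = of_nat DIM('a) * emeasure lborel (sgn -` A \<inter> ?D)"
    unfolding sphere_measure_def using m A'
    by (subst emeasure_distr)
       (auto simp: emeasure_restrict_space space_restrict_space space_scale_measure
         cong: measurable_cong_sets)
  also have "sgn -` A \<inter> ?D = {x \<in> ?D. sgn x \<in> A}" by auto
  finally show ?thesis .
qed

lemma finite_measure_sphere_measure: "finite_measure (sphere_measure :: 'a::euclidean_space measure)"
proof
  have "emeasure sphere_measure (sphere 0 1 :: 'a set)
      \<le> of_nat DIM('a) * emeasure lborel (ball 0 1 :: 'a set)"
    by (subst emeasure_sphere_measure) (auto intro!: mult_left_mono emeasure_mono)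
  also have "\<dots> < \<infinity>"
    using emeasure_lborel_ball_finite[of "0::'a" 1] by (simp add: ennreal_mult_less_top of_nat_less_top)
  finally show "emeasure sphere_measure (space sphere_measure :: 'a set) \<noteq> \<infinity>" by simp
qed

lemma borel_measurable_sphere_measure:
  assumes "continuous_on UNIV (g :: 'a::euclidean_space \<Rightarrow> 'b::topological_space)"
  shows "g \<in> borel_measurable sphere_measure"
  using borel_measurable_continuous_onI[OF assms]
  by (simp add: measurable_restrict_space1 cong: measurable_cong_sets)

lemma integrable_sphere_measure:
  fixes g :: "'a::euclidean_space \<Rightarrow> 'b::{banach, second_countable_topology}"
  assumes "continuous_on UNIV g"
  shows "integrable sphere_measure g"
proof -
  have "compact (g ` sphere 0 1)"
    by (intro compact_continuous_image compact_sphere continuous_on_subset[OF assms]) auto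
  then have "bounded (g ` sphere 0 1)" by (rule compact_imp_bounded)
  then obtain B where "\<And>x. x \<in> sphere 0 1 \<Longrightarrow> norm (g x) \<le> B"
    unfolding bounded_iff by (meson imageI)
  then show ?thesis
    by (intro finite_measure.integrable_const_bound[OF finite_measure_sphere_measure, of _ B]
        borel_measurable_sphere_measure assms AE_I2) simp_all
qed

lemma sphere_measure_open_pos:
  fixes U :: "'a::euclidean_space set"
  assumes U: "open U" and w: "w \<in> U" "norm w = 1"
  shows "emeasure sphere_measure (U \<inter> sphere 0 1) \<noteq> 0"
proof -
  let ?V = "{x \<in> ball 0 1 - {0}. sgn x \<in> U}"
  have "continuous_on (ball 0 1 - {0} :: 'a set) sgn"
    by (auto simp: sgn_div_norm[abs_def] intro!: continuous_intros)
  moreover have "open (ball 0 1 - {0} :: 'a set)" by auto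
  ultimately have "open ?V"
    using U by (simp add: continuous_on_open_vimage vimage_def Int_def conj_commute)
  moreover have "w /\<^sub>R 2 \<in> ?V" using w by (auto simp: sgn_div_norm)
  ultimately have "emeasure lborel ?V > 0" by (intro emeasure_lborel_open_pos) blast+
  moreover have "{x \<in> ball 0 1 - {0}. sgn x \<in> U \<inter> sphere 0 1} = ?V" by (auto simp: norm_sgn)
  ultimately show ?thesis
    using U by (subst emeasure_sphere_measure) auto
qed

lemma sphere_measure_distr_linear_isometry:
  fixes R :: "'a::euclidean_space \<Rightarrow> 'a"
  assumes lin: "linear R" and iso: "\<And>x. norm (R x) = norm x"
  shows "distr sphere_measure sphere_measure R = sphere_measure"
proof -
  have [measurable]: "R \<in> borel_measurable borel"
    using lin by (intro borel_measurable_continuous_onI linear_continuous_on linear_conv_bounded_linear[THEN iffD1])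
  have m: "R \<in> sphere_measure \<rightarrow>\<^sub>M sphere_measure"
    by (subst measurable_cong_sets[OF sets_sphere_measure sets_sphere_measure])
       (auto intro!: measurable_restrict_space3 simp: iso)
  show ?thesis
  proof (rule measure_eqI)
    fix A assume "A \<in> sets (distr sphere_measure sphere_measure R)"
    then have A: "A \<in> sets borel" "A \<subseteq> sphere 0 1" by (auto simp: sets_restrict_space_iff)
    let ?D = "ball 0 1 - {0} :: 'a set"
    have RA: "R -` A \<in> sets borel" using measurable_sets[OF _ A(1), of R borel] by simp
    have sub: "R -` A \<subseteq> sphere 0 1" using A(2) iso by auto
    have sA: "{x \<in> ?D. sgn x \<in> A} \<in> sets borel"
    proof -
      have "{x \<in> ?D. sgn x \<in> A} = sgn -` A \<inter> ?D" by auto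
      then show ?thesis using measurable_sets[OF measurable_sgn_borel A(1)] by simp
    qed
    have "emeasure (distr sphere_measure sphere_measure R) A = emeasure sphere_measure (R -` A)"
      using m A sub by (subst emeasure_distr) (auto simp: sets_restrict_space_iff Int_absorb2)
    also have "\<dots> = of_nat DIM('a) * emeasure lborel {x \<in> ?D. sgn x \<in> R -` A}"
      by (rule emeasure_sphere_measure[OF RA sub])
    also have "{x \<in> ?D. sgn x \<in> R -` A} = R -` {x \<in> ?D. sgn x \<in> A}"
    proof -
      have "sgn (R x) = R (sgn x)" for x
        using lin by (simp add: sgn_div_norm iso linear_cmul)
      moreover have "R x = 0 \<longleftrightarrow> x = 0" for x using iso[of x] by (metis norm_eq_zero)
      ultimately show ?thesis by (auto simp: iso)
    qed
    also have "emeasure lborel (R -` {x \<in> ?D. sgn x \<in> A}) = emeasure lborel {x \<in> ?D. sgn x \<in> A}"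
      using sA by (subst (2) lborel_distr_linear_isometry[OF lin iso, symmetric])
        (simp add: emeasure_distr)
    also have "of_nat DIM('a) * \<dots> = emeasure sphere_measure A"
      by (rule emeasure_sphere_measure[OF A, symmetric])
    finally show "emeasure (distr sphere_measure sphere_measure R) A = emeasure sphere_measure A" .
  qed simp
qed

section \<open>Rotations of a coordinate plane and orthogonality to polynomials\<close>

locale coordinate_plane =
  fixes u v :: "'a::euclidean_space"
  assumes u: "u \<in> Basis" and v: "v \<in> Basis" and uv: "u \<noteq> v"
begin

lemma inner_uv [simp]: "u \<bullet> u = 1" "v \<bullet> v = 1" "u \<bullet> v = 0" "v \<bullet> u = 0"
  using u v uv by (auto simp: inner_Basis)

definition zeta :: "'a \<Rightarrow> complex" where
  "zeta x = Complex (x \<bullet> u) (x \<bullet> v)"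

definition rot :: "real \<Rightarrow> 'a \<Rightarrow> 'a" where
  "rot \<theta> x = x + ((cos \<theta> - 1) * (x \<bullet> u) - sin \<theta> * (x \<bullet> v)) *\<^sub>R u
                + (sin \<theta> * (x \<bullet> u) + (cos \<theta> - 1) * (x \<bullet> v)) *\<^sub>R v"

lemma inner_rot [simp]:
  "rot \<theta> x \<bullet> u = cos \<theta> * (x \<bullet> u) - sin \<theta> * (x \<bullet> v)"
  "rot \<theta> x \<bullet> v = sin \<theta> * (x \<bullet> u) + cos \<theta> * (x \<bullet> v)"
  by (simp_all add: rot_def inner_add_left algebra_simps)

lemma linear_rot: "linear (rot \<theta>)"
  by (rule linearI) (simp_all add: rot_def inner_add_left algebra_simps)

lemma norm_rot: "norm (rot \<theta> x) = norm x"
proof -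
  define p where "p = (cos \<theta> - 1) * (x \<bullet> u) - sin \<theta> * (x \<bullet> v)"
  define q where "q = sin \<theta> * (x \<bullet> u) + (cos \<theta> - 1) * (x \<bullet> v)"
  have "rot \<theta> x \<bullet> rot \<theta> x = x \<bullet> x + ((x \<bullet> u + p)\<^sup>2 - (x \<bullet> u)\<^sup>2) + ((x \<bullet> v + q)\<^sup>2 - (x \<bullet> v)\<^sup>2)"
    unfolding rot_def p_def[symmetric] q_def[symmetric]
    by (simp add: inner_add_left inner_add_right inner_commute[of u x] inner_commute[of v x]
        power2_eq_square algebra_simps)
  also have "\<dots> = x \<bullet> x + ((cos \<theta>)\<^sup>2 + (sin \<theta>)\<^sup>2 - 1) * ((x \<bullet> u)\<^sup>2 + (x \<bullet> v)\<^sup>2)"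
  proof -
    have "(\<alpha> + ((c - 1) * \<alpha> - s * \<beta>))\<^sup>2 - \<alpha>\<^sup>2 + ((\<beta> + (s * \<alpha> + (c - 1) * \<beta>))\<^sup>2 - \<beta>\<^sup>2)
        = (c\<^sup>2 + s\<^sup>2 - 1) * (\<alpha>\<^sup>2 + \<beta>\<^sup>2)" for \<alpha> \<beta> c s :: real
      by (simp add: power2_eq_square algebra_simps)
    from this[of "x \<bullet> u" "cos \<theta>" "sin \<theta>" "x \<bullet> v"] show ?thesis
      unfolding p_def q_def by linarith
  qed
  finally show ?thesis by (simp add: norm_eq_sqrt_inner)
qed

lemma zeta_rot: "zeta (rot \<theta> x) = cis \<theta> * zeta x"
  by (simp add: zeta_def complex_eq_iff)

lemma continuous_on_zeta: "continuous_on A zeta"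
  unfolding zeta_def[abs_def] Complex_eq by (intro continuous_intros)

text \<open>
  The isotypic components of the circle action on continuous functions.
\<close>

definition rot_weight :: "int \<Rightarrow> ('a \<Rightarrow> complex) \<Rightarrow> bool" where
  "rot_weight k g \<longleftrightarrow> continuous_on UNIV g \<and> (\<forall>\<theta> x. g (rot \<theta> x) = cis (of_int k * \<theta>) * g x)"

lemma rot_weight_mult:
  assumes "rot_weight k g" "rot_weight l h"
  shows "rot_weight (k + l) (\<lambda>x. g x * h x)"
  using assms by (auto simp: rot_weight_def cis_mult[symmetric] distrib_right intro!: continuous_intros)

lemma rot_weight_zeta_power: "rot_weight (int n) (\<lambda>x. zeta x ^ n)"
  by (auto simp: rot_weight_def zeta_rot power_mult_distrib Complex.DeMoivre intro!: continuous_intros continuous_on_zeta)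

lemma rot_weight_cnj_zeta_power: "rot_weight (- int n) (\<lambda>x. cnj (zeta x) ^ n)"
  by (auto simp: rot_weight_def zeta_rot power_mult_distrib Complex.DeMoivre cis_cnj
      simp flip: complex_cnj_power intro!: continuous_intros continuous_on_zeta)

text \<open>
  The half period rotation \<open>\<theta> = pi / k\<close> preserves the measure and changes the sign of \<open>g\<close>.
\<close>

lemma integral_rot_weight:
  assumes g: "rot_weight k g" and k: "k \<noteq> 0"
  shows "(LINT \<omega>|sphere_measure. g \<omega>) = 0"
proof -
  define \<theta> where "\<theta> = pi / of_int k"
  have cont: "continuous_on UNIV g" using g by (simp add: rot_weight_def)
  have flip: "g (rot \<theta> x) = - g x" for x
    using g k by (simp add: rot_weight_def \<theta>_def)
  have rot: "rot \<theta> \<in> sphere_measure \<rightarrow>\<^sub>M sphere_measure"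
    unfolding measurable_cong_sets[OF sets_sphere_measure sets_sphere_measure]
    by (intro measurable_restrict_space3 borel_measurable_continuous_onI linear_continuous_on
        linear_conv_bounded_linear[THEN iffD1] linear_rot) (auto simp: norm_rot)
  have "(LINT \<omega>|sphere_measure. g \<omega>) = (LINT \<omega>|distr sphere_measure sphere_measure (rot \<theta>). g \<omega>)"
    by (simp add: sphere_measure_distr_linear_isometry linear_rot norm_rot)
  also have "\<dots> = (LINT \<omega>|sphere_measure. g (rot \<theta> \<omega>))"
    by (rule integral_distr[OF rot borel_measurable_sphere_measure[OF cont]])
  also have "\<dots> = - (LINT \<omega>|sphere_measure. g \<omega>)"
    by (simp add: flip)
  finally show ?thesis by simp
qed

text \<open>
  Functions with only finitely many frequencies under rotation: the analogue of trigonometric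
  polynomials. They form an algebra that contains all polynomials.
\<close>

inductive rot_finite :: "('a \<Rightarrow> complex) \<Rightarrow> bool" where
  single: "rot_weight k g \<Longrightarrow> rot_finite g"
| add: "rot_finite g \<Longrightarrow> rot_finite h \<Longrightarrow> rot_finite (\<lambda>x. g x + h x)"

lemma rot_finite_mult:
  assumes "rot_finite g" "rot_finite h"
  shows "rot_finite (\<lambda>x. g x * h x)"
  using assms
proof (induction g)
  case (single k g)
  from single(2,1) show ?case
  proof (induction h)
    case (single l h)
    then show ?case using rot_weight_mult by (blast intro: rot_finite.single)
  next
    case (add h1 h2)
    then show ?case by (auto simp: distrib_left intro: rot_finite.add)
  qed
next
  case (add g1 g2)
  then show ?case by (auto simp: distrib_right intro: rot_finite.add)
qed

text \<open>
  A linear form splits along the plane and its orthogonal complement: on the plane it is a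
  combination of \<open>\<zeta>\<close> and its conjugate, of weights \<open>1\<close> and \<open>-1\<close>; on the complement
  rotations act trivially.
\<close>

lemma rot_finite_linear:
  assumes f: "bounded_linear f"
  shows "rot_finite (\<lambda>x. complex_of_real (f x))"
proof -
  define P where "P x = x - (x \<bullet> u) *\<^sub>R u - (x \<bullet> v) *\<^sub>R v" for x
  define C where "C = (f u - \<i> * f v) / 2"
  define D where "D = (f u + \<i> * f v) / 2"
  interpret f: bounded_linear f by fact
  have "complex_of_real (f x) = C * zeta x ^ 1 + D * cnj (zeta x) ^ 1 + complex_of_real (f (P x))" for x
  proof -
    have "f x = f ((x \<bullet> u) *\<^sub>R u + (x \<bullet> v) *\<^sub>R v + P x)" by (simp add: P_def)
    also have "\<dots> = (x \<bullet> u) * f u + (x \<bullet> v) * f v + f (P x)" by (simp add: f.add f.scaleR)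
    finally show ?thesis by (simp add: C_def D_def zeta_def complex_eq_iff) (simp add: field_simps)
  qed
  then have eq: "(\<lambda>x. complex_of_real (f x)) =
      (\<lambda>x. C * zeta x ^ 1 + D * cnj (zeta x) ^ 1 + complex_of_real (f (P x)))" by blast
  have const: "rot_weight 0 (\<lambda>x. c)" for c by (simp add: rot_weight_def)
  have "P (rot \<theta> x) = P x" for \<theta> x
    by (simp add: P_def) (simp add: rot_def algebra_simps)
  moreover have "continuous_on UNIV (\<lambda>x. complex_of_real (f (P x)))"
    unfolding P_def by (intro continuous_intros f.continuous_on)
  ultimately have "rot_weight 0 (\<lambda>x. complex_of_real (f (P x)))"
    by (simp add: rot_weight_def)
  then show ?thesis unfolding eq
    by (intro rot_finite.add rot_finite_mult)
       (rule rot_finite.single, rule const rot_weight_zeta_power rot_weight_cnj_zeta_power | blast intro: rot_finite.single)+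
qed

lemma rot_finite_of_real_polynomial:
  "real_polynomial_function f \<Longrightarrow> rot_finite (\<lambda>x. complex_of_real (f x))"
proof (induction rule: real_polynomial_function.induct)
  case (const c)
  show ?case by (rule rot_finite.single[of 0]) (simp add: rot_weight_def)
qed (auto intro: rot_finite_linear rot_finite.add rot_finite_mult)

lemma rot_finite_polynomial:
  assumes "polynomial_function p"
  shows "rot_finite p"
proof -
  have "real_polynomial_function (\<lambda>x. Re (p x))" "real_polynomial_function (\<lambda>x. Im (p x))"
    using assms bounded_linear_Re bounded_linear_Im by (auto simp: polynomial_function_def o_def)
  then have "rot_finite (\<lambda>x. complex_of_real (Re (p x)) + \<i> * complex_of_real (Im (p x)))"
    by (intro rot_finite.add rot_finite_mult rot_finite_of_real_polynomial)
       (auto intro!: rot_finite.single[of 0] simp: rot_weight_def)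
  then show ?thesis by (simp add: complex_eq[symmetric])
qed

lemma rot_finite_continuous: "rot_finite g \<Longrightarrow> continuous_on UNIV g"
  by (induction rule: rot_finite.induct) (auto simp: rot_weight_def intro!: continuous_intros)

text \<open>
  A component of weight \<open>k\<close> gets the weight \<open>k + n\<close> or \<open>k - n\<close> in the product, which is nonzero as soon
  as \<open>n > \<bar>k\<bar>\<close>.
\<close>

lemma rot_finite_orthogonal:
  "rot_finite g \<Longrightarrow> \<exists>N. \<forall>n\<ge>N. (LINT \<omega>|sphere_measure. zeta \<omega> ^ n * g \<omega>) = 0 \<and>
     (LINT \<omega>|sphere_measure. cnj (zeta \<omega>) ^ n * g \<omega>) = 0"
proof (induction rule: rot_finite.induct)
  case (single k g)
  have "(LINT \<omega>|sphere_measure. zeta \<omega> ^ n * g \<omega>) = 0 \<and>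
     (LINT \<omega>|sphere_measure. cnj (zeta \<omega>) ^ n * g \<omega>) = 0" if "n \<ge> nat \<bar>k\<bar> + 1" for n
  proof
    show "(LINT \<omega>|sphere_measure. zeta \<omega> ^ n * g \<omega>) = 0"
      by (rule integral_rot_weight[OF rot_weight_mult[OF rot_weight_zeta_power single]]) (use that in linarith)
    show "(LINT \<omega>|sphere_measure. cnj (zeta \<omega>) ^ n * g \<omega>) = 0"
      by (rule integral_rot_weight[OF rot_weight_mult[OF rot_weight_cnj_zeta_power single]]) (use that in linarith)
  qed
  then show ?case by blast
next
  case (add g h)
  then obtain N1 N2 where N:
    "\<And>n. n \<ge> N1 \<Longrightarrow> (LINT \<omega>|sphere_measure. zeta \<omega> ^ n * g \<omega>) = 0"
    "\<And>n. n \<ge> N1 \<Longrightarrow> (LINT \<omega>|sphere_measure. cnj (zeta \<omega>) ^ n * g \<omega>) = 0"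
    "\<And>n. n \<ge> N2 \<Longrightarrow> (LINT \<omega>|sphere_measure. zeta \<omega> ^ n * h \<omega>) = 0"
    "\<And>n. n \<ge> N2 \<Longrightarrow> (LINT \<omega>|sphere_measure. cnj (zeta \<omega>) ^ n * h \<omega>) = 0"
    by blast
  have "integrable sphere_measure (\<lambda>\<omega>. zeta \<omega> ^ n * f \<omega>)"
       "integrable sphere_measure (\<lambda>\<omega>. cnj (zeta \<omega>) ^ n * f \<omega>)" if "rot_finite f" for f n
    using rot_finite_continuous[OF that]
    by (auto intro!: integrable_sphere_measure continuous_intros continuous_on_zeta)
  with add.hyps N show ?case
    by (intro exI[of _ "max N1 N2"]) (auto simp: distrib_left Bochner_Integration.integral_add)
qed

lemma eventually_orthogonal_Re_zeta_power:
  assumes "polynomial_function p"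
  shows "\<exists>N. \<forall>n\<ge>N. (LINT \<omega>|sphere_measure. complex_of_real (Re (zeta \<omega> ^ n)) * p \<omega>) = 0"
proof -
  have p: "rot_finite p" by (rule rot_finite_polynomial[OF assms])
  obtain N where N: "\<And>n. n \<ge> N \<Longrightarrow> (LINT \<omega>|sphere_measure. zeta \<omega> ^ n * p \<omega>) = 0"
    "\<And>n. n \<ge> N \<Longrightarrow> (LINT \<omega>|sphere_measure. cnj (zeta \<omega>) ^ n * p \<omega>) = 0"
    using rot_finite_orthogonal[OF p] by blast
  have int: "integrable sphere_measure (\<lambda>\<omega>. zeta \<omega> ^ n * p \<omega>)"
       "integrable sphere_measure (\<lambda>\<omega>. cnj (zeta \<omega>) ^ n * p \<omega>)" for n
    using rot_finite_continuous[OF p]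
    by (auto intro!: integrable_sphere_measure continuous_intros continuous_on_zeta)
  have eq: "complex_of_real (Re (zeta \<omega> ^ n)) * p \<omega> =
      1/2 * (zeta \<omega> ^ n * p \<omega>) + 1/2 * (cnj (zeta \<omega>) ^ n * p \<omega>)" for \<omega> n
  proof -
    have "complex_of_real (Re Z) * w = 1/2 * (Z * w) + 1/2 * (cnj Z * w)" for Z w :: complex
      by (simp add: complex_eq_iff field_simps)
    from this[of "zeta \<omega> ^ n" "p \<omega>"] show ?thesis by simp
  qed
  have "(LINT \<omega>|sphere_measure. complex_of_real (Re (zeta \<omega> ^ n)) * p \<omega>) = 0" if "n \<ge> N" for n
    unfolding eq using int[of n] N[OF that] by (subst Bochner_Integration.integral_add) auto
  then show ?thesis by blast
qed

end

section \<open>Hypergeometric series at the boundary of the unit disc\<close>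

definition hyp2F1_coeff :: "real \<Rightarrow> real \<Rightarrow> real \<Rightarrow> nat \<Rightarrow> real" where
  "hyp2F1_coeff a b c n = pochhammer a n * pochhammer b n / (pochhammer c n * fact n)"

lemma hyp2F1_coeff_0 [simp]: "hyp2F1_coeff a b c 0 = 1"
  by (simp add: hyp2F1_coeff_def)

lemma hyp2F1_coeff_Suc:
  assumes "c \<notin> \<int>"
  shows "real (Suc n) * (c + n) * hyp2F1_coeff a b c (Suc n) = (a + n) * (b + n) * hyp2F1_coeff a b c n"
proof -
  have p: "pochhammer c n \<noteq> 0" "c + n \<noteq> 0"
    using assms by (auto simp: pochhammer_eq_0_iff add_eq_0_iff2)
  show ?thesis
    unfolding hyp2F1_coeff_def pochhammer_Suc fact_Suc using p
    by (simp add: divide_simps del: of_nat_Suc)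
qed

text \<open>
  Unless the series terminates, its coefficients decay like \<open>n powr (a + b - c - 1)\<close>, so the factor \<open>n\<close> costs one unit of the
  convergence margin \<open>c - a - b > 0\<close> of the series at \<open>1\<close>. The extra factor provides the vanishing
  boundary term in the contiguous relation below.
\<close>

lemma summable_hyp2F1_weighted:
  assumes c: "c \<notin> \<int>" and margin: "c - a - b > 1"
  shows "summable (\<lambda>n. real n * \<bar>hyp2F1_coeff a b c n\<bar>)"
proof (cases "\<exists>n. hyp2F1_coeff a b c n = 0")
  case True
  then obtain N where N: "hyp2F1_coeff a b c N = 0" by blast
  have cn: "c + n \<noteq> 0" for n :: nat
    using c by (auto simp: add_eq_0_iff2)
  have "hyp2F1_coeff a b c n = 0" if "n \<ge> N" for n
    using that
  proof (induction rule: dec_induct)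
    case (step n)
    then show ?case using hyp2F1_coeff_Suc[OF c, of n a b] cn[of n] by simp
  qed (fact N)
  then have "summable (\<lambda>n. real n * \<bar>hyp2F1_coeff a b c n\<bar>) = summable (\<lambda>n. 0 :: real)"
    by (intro summable_cong eventually_sequentiallyI[of N]) simp
  then show ?thesis by simp
next
  case False
  define f where "f n = real n * \<bar>hyp2F1_coeff a b c n\<bar>" for n
  have pos: "f n > 0" if "n > 0" for n using False that by (simp add: f_def)
  have "eventually (\<lambda>n. a + real n > 0 \<and> b + real n > 0 \<and> c + real n > 0 \<and> n > 0) sequentially"
    by (intro eventually_conj; real_asymp)
  then have ev: "eventually (\<lambda>n. real n * (f n / f (Suc n) - 1) =
      real n * ((c - a - b) * real n - a * b) / ((a + real n) * (b + real n))) sequentially"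
  proof eventually_elim
    case (elim n)
    let ?A = "\<bar>hyp2F1_coeff a b c n\<bar>" and ?B = "\<bar>hyp2F1_coeff a b c (Suc n)\<bar>"
    have "\<bar>real (Suc n) * (c + n) * hyp2F1_coeff a b c (Suc n)\<bar> = \<bar>(a + n) * (b + n) * hyp2F1_coeff a b c n\<bar>"
      by (simp only: hyp2F1_coeff_Suc[OF c])
    then have "real (Suc n) * (c + n) * ?B = (a + n) * (b + n) * ?A"
      using elim by (simp add: abs_mult del: of_nat_Suc)
    then have eq: "real (Suc n) * ?B = (a + n) * (b + n) * ?A / (c + n)"
      using elim by (simp add: nonzero_eq_divide_eq mult_ac del: of_nat_Suc)
    have A: "?A > 0" using False by simp
    have ratio: "f n / f (Suc n) = real n * (c + n) / ((a + n) * (b + n))"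
    proof -
      have "real n * x / (P * x / Q) = real n * Q / P" if "x > 0" "P > 0" "Q > 0" for x P Q :: real
        using that by (simp add: field_simps)
      from this[OF A, of "(a + n) * (b + n)" "c + n"] show ?thesis
        unfolding f_def eq using elim by simp
    qed
    show ?case unfolding ratio using elim by (simp add: divide_simps) (simp add: algebra_simps)
  qed
  have "(\<lambda>n. real n * ((c - a - b) * real n - a * b) / ((a + real n) * (b + real n))) \<longlonglongrightarrow> c - a - b"
    using margin by real_asymp
  then have "(\<lambda>n. real n * (f n / f (Suc n) - 1)) \<longlonglongrightarrow> c - a - b"
    by (subst tendsto_cong[OF ev])
  then have "liminf (\<lambda>n. ereal (real n * (f n / f (Suc n) - 1))) = ereal (c - a - b)"
    by (intro lim_imp_Liminf) auto
  then have "summable f"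
    using margin pos by (intro raabes_test_convergence) (auto intro: eventually_mono[OF eventually_gt_at_top[of 0]])
  then show ?thesis by (simp add: f_def[abs_def])
qed

lemma summable_hyp2F1:
  assumes c: "c \<notin> \<int>" and margin: "c - a - b > 1" and x: "\<bar>x\<bar> \<le> 1"
  shows "summable (\<lambda>n. hyp2F1_coeff a b c n * x ^ n)" "summable (\<lambda>n. \<bar>hyp2F1_coeff a b c n\<bar>)"
proof -
  let ?A = "hyp2F1_coeff a b c"
  show s: "summable (\<lambda>n. \<bar>?A n\<bar>)"
  proof (rule summable_comparison_test[OF _ summable_hyp2F1_weighted[OF c margin]])
    show "\<exists>N. \<forall>n\<ge>N. norm \<bar>?A n\<bar> \<le> real n * \<bar>?A n\<bar>"
      by (intro exI[of _ 1]) (auto simp: mult_le_cancel_right1)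
  qed
  show "summable (\<lambda>n. ?A n * x ^ n)"
    by (rule summable_comparison_test[OF _ s])
       (use x in \<open>auto simp: abs_mult power_abs intro!: mult_left_le power_le_one\<close>)
qed

text \<open>
  Gauss's contiguous relation for the values at \<open>1\<close>. The difference of the two sides telescopes
  termwise; the telescoping sequence \<open>u\<close> below is the one found by Gosper's algorithm.
\<close>

lemma hyp2F1_contiguous:
  assumes c: "c \<notin> \<int>" and margin: "c - a - b > 2" and b: "b \<ge> 0"
  shows "(c - a - b - 1) * (\<Sum>n. hyp2F1_coeff a (b + 1) c n) = (c - b - 1) * (\<Sum>n. hyp2F1_coeff a b c n)"
proof -
  let ?E = "hyp2F1_coeff a (b + 1) c" and ?A = "hyp2F1_coeff a b c"
  define u where "u n = (if n = 0 then 0 else (a + real (n - 1)) * ?E (n - 1))" for n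
  have E: "?E sums suminf ?E" and A: "?A sums suminf ?A"
    using summable_hyp2F1(1)[OF c, of a _ 1] margin by (auto intro: summable_sums)
  have step: "(c - b - 1) * ?A n - (c - a - b - 1) * ?E n = u (Suc n) - u n" for n
  proof (cases n)
    case 0
    then show ?thesis by (simp add: u_def)
  next
    case (Suc m)
    have bn: "b + real n > 0" using b Suc by simp
    have poch: "b * pochhammer (b + 1) n = pochhammer b n * (b + real n)"
      by (metis pochhammer_rec pochhammer_Suc)
    have "(b + n) * ?A n = b * ?E n"
      unfolding hyp2F1_coeff_def using arg_cong[OF poch, of "\<lambda>z. z * (pochhammer a n / (pochhammer c n * fact n))"]
      by (auto simp: mult_ac)
    then have 1: "?A n = b * ?E n / (b + n)" using bn by (simp add: field_simps)
    have "real n * (c + n - 1) * ?E n = (b + n) * u n"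
      using hyp2F1_coeff_Suc[OF c, of m a "b + 1"] by (simp add: u_def Suc algebra_simps)
    then have 2: "u n = real n * (c + n - 1) * ?E n / (b + n)" using bn by (simp add: field_simps)
    have 3: "u (Suc n) = (a + n) * ?E n" by (simp add: u_def)
    show ?thesis unfolding 1 2 3 using bn
      by (simp add: divide_simps) (simp add: algebra_simps)
  qed
  have "(\<lambda>n. \<bar>a\<bar> * \<bar>?E n\<bar> + real n * \<bar>?E n\<bar>) \<longlonglongrightarrow> \<bar>a\<bar> * 0 + 0"
    by (intro tendsto_intros summable_LIMSEQ_zero summable_hyp2F1(2)[where x = 1] summable_hyp2F1_weighted)
       (use c margin in auto)
  then have lim: "(\<lambda>n. \<bar>a\<bar> * \<bar>?E n\<bar> + real n * \<bar>?E n\<bar>) \<longlonglongrightarrow> 0" by simp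
  have "norm (u (Suc n)) \<le> \<bar>a\<bar> * \<bar>?E n\<bar> + real n * \<bar>?E n\<bar>" for n
    by (auto simp: u_def abs_mult intro!: mult_right_mono simp flip: distrib_right)
  then have "(\<lambda>n. u (Suc n)) \<longlonglongrightarrow> 0"
    by (intro Lim_null_comparison[OF _ lim] always_eventually) blast
  then have "u \<longlonglongrightarrow> 0" by (rule LIMSEQ_imp_Suc)
  then have "(\<lambda>n. u (Suc n) - u n) sums (0 - u 0)" by (rule telescope_sums)
  moreover have "(\<lambda>n. (c - b - 1) * ?A n - (c - a - b - 1) * ?E n) sums
      ((c - b - 1) * suminf ?A - (c - a - b - 1) * suminf ?E)"
    by (intro sums_diff sums_mult A E)
  ultimately show ?thesis
    unfolding step by (simp add: u_def sums_iff)
qed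

text \<open>
  For \<open>q = 0\<close> the series is the constant \<open>1\<close>. Each step of the contiguous relation multiplies the
  value by \<open>(c - q - 1) / (c - a - q - 1)\<close>, which is nonzero since \<open>c\<close> is not an integer.
\<close>

lemma hyp2F1_at_1_nonzero:
  assumes c: "c \<notin> \<int>" and margin: "c - a - real q > 1"
  shows "(\<Sum>n. hyp2F1_coeff a (real q) c n) \<noteq> 0"
  using margin
proof (induction q)
  case 0
  have "(\<lambda>n. hyp2F1_coeff a 0 c n) = (\<lambda>n. if n = 0 then 1 else 0)"
    by (auto simp: hyp2F1_coeff_def pochhammer_0_left fun_eq_iff)
  moreover have "(\<Sum>n. if n = (0::nat) then 1 else (0::real)) = 1"
    using sums_If_finite_set[of "{0::nat}" "\<lambda>_. 1 :: real"] by (simp add: sums_iff)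
  ultimately show ?case by simp
next
  case (Suc q)
  have "c - real q - 1 \<noteq> 0"
  proof
    assume "c - real q - 1 = 0"
    then have "c = of_int (int q + 1)" by simp
    then show False using c by (metis Ints_of_int)
  qed
  with Suc hyp2F1_contiguous[OF c, of a "real q"] show ?case
    by (auto simp: add.commute)
qed

lemma continuous_on_hyp2F1:
  assumes c: "c \<notin> \<int>" and margin: "c - a - b > 1"
  shows "continuous_on {0..1} (\<lambda>x. \<Sum>n. hyp2F1_coeff a b c n * x ^ n)"
proof -
  have "uniform_limit {0..1} (\<lambda>n x. \<Sum>i<n. hyp2F1_coeff a b c i * x ^ i) (\<lambda>x. \<Sum>n. hyp2F1_coeff a b c n * x ^ n) sequentially"
    by (rule Weierstrass_m_test[OF _ summable_hyp2F1(2)[OF c margin, of 1]])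
       (auto simp: abs_mult intro!: mult_left_le power_le_one)
  then show ?thesis
    by (rule uniform_limit_theorem[rotated])
       (auto intro!: always_eventually continuous_intros)
qed

text \<open>
  Gauss's hypergeometric equation. The left hand side minus the right hand side
  is a power series whose \<open>n\<close>-th coefficient is the difference of the two sides of
  \<open>(n + 1) (c + n) A(n+1) = (a + n) (b + n) A(n)\<close>.
\<close>

lemma hyp2F1_ode:
  fixes x :: real
  assumes c: "c \<notin> \<int>" and margin: "c - a - b > 1" and x: "\<bar>x\<bar> < 1"
  defines "A \<equiv> hyp2F1_coeff a b c"
  shows "x * (1 - x) * (\<Sum>n. diffs (diffs A) n * x ^ n) + (c - (a + b + 1) * x) * (\<Sum>n. diffs A n * x ^ n)
    = a * b * (\<Sum>n. A n * x ^ n)"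
proof -
  let ?F = "\<Sum>n. A n * x ^ n" and ?F1 = "\<Sum>n. diffs A n * x ^ n" and ?F2 = "\<Sum>n. diffs (diffs A) n * x ^ n"
  have s0: "\<And>x. norm x < 1 \<Longrightarrow> summable (\<lambda>n. A n * x ^ n)"
    using summable_hyp2F1(1)[OF c margin] by (simp add: A_def)
  have s1: "\<And>x. norm x < 1 \<Longrightarrow> summable (\<lambda>n. diffs A n * x ^ n)"
    by (rule termdiff_converges[OF _ s0])
  have s2: "\<And>x. norm x < 1 \<Longrightarrow> summable (\<lambda>n. diffs (diffs A) n * x ^ n)"
    by (rule termdiff_converges[OF _ s1])
  have shift: "x * (real n * r * x ^ (n - Suc 0)) = real n * r * x ^ n" for r n
    by (cases n) auto
  have F: "(\<lambda>n. A n * x ^ n) sums ?F" and F1: "(\<lambda>n. diffs A n * x ^ n) sums ?F1"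
    using s0 s1 x by (auto intro: summable_sums)
  have "(\<lambda>n. x * (real n * A n * x ^ (n - Suc 0))) sums (x * ?F1)"
    using diffs_equiv[OF s1] x by (intro sums_mult) auto
  then have xF1: "(\<lambda>n. real n * A n * x ^ n) sums (x * ?F1)"
    by (simp only: shift)
  have "(\<lambda>n. x * (real n * diffs A n * x ^ (n - Suc 0))) sums (x * ?F2)"
    using diffs_equiv[OF s2] x by (intro sums_mult) auto
  then have xF2: "(\<lambda>n. real n * diffs A n * x ^ n) sums (x * ?F2)"
    by (simp only: shift)
  have "(\<lambda>n. x * (real n * diffs A n * x ^ n)) sums (x * (x * ?F2))"
    by (intro sums_mult xF2)
  then have "(\<lambda>n. real (Suc n) * (real (Suc n) - 1) * A (Suc n) * x ^ Suc n) sums (x * (x * ?F2))"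
    by (simp add: diffs_def mult_ac)
  then have xxF2: "(\<lambda>n. real n * (real n - 1) * A n * x ^ n) sums (x * (x * ?F2))"
    by (subst (asm) sums_Suc_iff) simp
  have "(\<lambda>n. (real n * diffs A n * x ^ n) - (real n * (real n - 1) * A n * x ^ n)
      + c * (diffs A n * x ^ n) - (a + b + 1) * (real n * A n * x ^ n) - a * b * (A n * x ^ n)) sums
     (x * ?F2 - x * (x * ?F2) + c * ?F1 - (a + b + 1) * (x * ?F1) - a * b * ?F)"
    by (intro sums_add sums_diff sums_mult F F1 xF1 xF2 xxF2)
  moreover have "(real n * diffs A n * x ^ n) - (real n * (real n - 1) * A n * x ^ n)
      + c * (diffs A n * x ^ n) - (a + b + 1) * (real n * A n * x ^ n) - a * b * (A n * x ^ n) = 0" for n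
  proof -
    have "(c + n) * diffs A n = (a + n) * (b + n) * A n"
      using hyp2F1_coeff_Suc[OF c, of n a b] by (simp add: A_def diffs_def mult_ac)
    then have "((c + n) * diffs A n - (a + n) * (b + n) * A n) * x ^ n = 0" by simp
    then show ?thesis by (simp add: algebra_simps)
  qed
  ultimately have "(\<lambda>n. 0) sums
     (x * ?F2 - x * (x * ?F2) + c * ?F1 - (a + b + 1) * (x * ?F1) - a * b * ?F)"
    by simp
  then have "x * ?F2 - x * (x * ?F2) + c * ?F1 - (a + b + 1) * (x * ?F1) - a * b * ?F = 0"
    using sums_0 sums_unique2 by blast
  then show ?thesis by (simp add: algebra_simps)
qed

section \<open>Smoothness of separated functions\<close>

lemma Ck_on_UNIV_if_closed_under_partials:
  fixes S :: "('b::euclidean_space \<Rightarrow> real) set"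
  assumes closed: "\<And>g. g \<in> S \<Longrightarrow> \<exists>D. (\<forall>x. (g has_derivative D x) (at x)) \<and> (\<forall>b\<in>Basis. (\<lambda>x. D x b) \<in> S)"
    and "g \<in> S"
  shows "Ck_on k g UNIV"
  using \<open>g \<in> S\<close>
proof (induction k arbitrary: g)
  case 0
  then obtain D where "\<And>x. (g has_derivative D x) (at x)" using closed by blast
  then show ?case by (auto intro!: continuous_at_imp_continuous_on has_derivative_continuous)
next
  case (Suc k)
  then obtain D where D: "\<And>x. (g has_derivative D x) (at x)" "\<And>b. b \<in> Basis \<Longrightarrow> (\<lambda>x. D x b) \<in> S"
    using closed by blast
  have "frechet_derivative g (at x) = D x" for x
    by (rule frechet_derivative_at[OF D(1), symmetric])
  then show ?case
    using D Suc.IH by (auto simp: differentiable_on_def intro!: differentiableI)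
qed

text \<open>
  The de Sitter time line compactified by the square of \<open>t / bracket t\<close>; the past and
  the future boundary become the point \<open>1\<close>, a regular singular point of the equation for the modes.
\<close>

definition compactified_time :: "real \<Rightarrow> real" where
  "compactified_time t = t\<^sup>2 / (1 + t\<^sup>2)"

lemma one_plus_square_pos [simp]: "1 + (t::real)\<^sup>2 > 0" "1 + (t::real)\<^sup>2 \<noteq> 0"
  by (auto simp: add_pos_nonneg add_nonneg_eq_0_iff)

lemma compactified_time_bounds: "0 \<le> compactified_time t" "compactified_time t < 1" "\<bar>compactified_time t\<bar> < 1"
  by (auto simp: compactified_time_def)

lemma DERIV_compactified_time:
  "(compactified_time has_real_derivative 2 * t / (1 + t\<^sup>2)\<^sup>2) (at t)"
proof -
  have "(compactified_time has_real_derivative (2 * t * (1 + t\<^sup>2) - t\<^sup>2 * (2 * t)) / ((1 + t\<^sup>2) * (1 + t\<^sup>2))) (at t)"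
    unfolding compactified_time_def[abs_def] by (auto intro!: derivative_eq_intros)
  then show ?thesis by (simp add: power2_eq_square algebra_simps)
qed

lemma DERIV_power_series_compactified_time:
  assumes c: "\<And>x::real. \<bar>x\<bar> < 1 \<Longrightarrow> summable (\<lambda>i. c i * x ^ i)"
  shows "((\<lambda>t. \<Sum>i. c i * compactified_time t ^ i) has_real_derivative
    (\<Sum>i. diffs c i * compactified_time t ^ i) * (2 * t / (1 + t\<^sup>2)\<^sup>2)) (at t)"
  using DERIV_chain2[OF termdiffs_strong'[where K = 1 and c = c] DERIV_compactified_time] c
  by (simp add: compactified_time_bounds)

context coordinate_plane
begin

lemma bounded_linear_zeta: "bounded_linear zeta"
  unfolding zeta_def[abs_def] Complex_eq
  by (intro bounded_linear_add bounded_linear_const_mult bounded_linear_of_real[THEN bounded_linear_compose] bounded_linear_inner_left)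

text \<open>
  A class of functions that contains the solution and is closed under partial derivatives, which
  makes all its members smooth. The spatial derivatives lower the power of \<open>\<zeta>\<close>; the time derivative
  changes \<open>j\<close> and \<open>m\<close> and replaces the power series by its derived series. The complex
  constant \<open>C\<close> absorbs all numerical factors, so that closure under sums is enough.
\<close>

inductive mode_function :: "(real \<times> 'a \<Rightarrow> real) \<Rightarrow> bool" where
  single: "(\<And>x::real. \<bar>x\<bar> < 1 \<Longrightarrow> summable (\<lambda>i. c i * x ^ i)) \<Longrightarrow>
    mode_function (\<lambda>z. Re (C * zeta (snd z) ^ n) *
      (fst z ^ j / (1 + (fst z)\<^sup>2) ^ m * (\<Sum>i. c i * compactified_time (fst z) ^ i)))"
| add: "mode_function f \<Longrightarrow> mode_function g \<Longrightarrow> mode_function (\<lambda>z. f z + g z)"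

lemma mode_function_partials:
  "mode_function g \<Longrightarrow> \<exists>D. (\<forall>x. (g has_derivative D x) (at x)) \<and> (\<forall>b\<in>Basis. mode_function (\<lambda>x. D x b))"
proof (induction rule: mode_function.induct)
  case (single c C n j m)
  define P where "P t = (\<Sum>i. c i * compactified_time t ^ i)" for t
  define P1 where "P1 t = (\<Sum>i. diffs c i * compactified_time t ^ i)" for t
  define r where "r t = t ^ j / (1 + t\<^sup>2) ^ m * P t" for t
  define r' where "r' t = real j * (t ^ (j - 1) / (1 + t\<^sup>2) ^ m * P t)
      + (- 2 * real m) * (t ^ Suc j / (1 + t\<^sup>2) ^ Suc m * P t)
      + 2 * (t ^ Suc j / (1 + t\<^sup>2) ^ (m + 2) * P1 t)" for t
  have dP: "(P has_real_derivative P1 t * (2 * t / (1 + t\<^sup>2)\<^sup>2)) (at t)" for t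
    unfolding P_def[abs_def] P1_def by (rule DERIV_power_series_compactified_time[OF single])
  have quot: "((\<lambda>t. t ^ j / (1 + t\<^sup>2) ^ m) has_real_derivative
      real j * t ^ (j - 1) / (1 + t\<^sup>2) ^ m - 2 * real m * t ^ Suc j / (1 + t\<^sup>2) ^ Suc m) (at t)" for t
  proof -
    have 1: "((\<lambda>t. t ^ j * inverse ((1 + t\<^sup>2) ^ m)) has_real_derivative
      t ^ j * (- (inverse ((1 + t\<^sup>2) ^ m) * (real m * (1 + t\<^sup>2) ^ (m - 1) * (2 * t)) * inverse ((1 + t\<^sup>2) ^ m)))
       + real j * t ^ (j - 1) * inverse ((1 + t\<^sup>2) ^ m)) (at t)"
      by (auto intro!: derivative_eq_intros)
    have 2: "inverse ((1 + t\<^sup>2) ^ m) * (real m * (1 + t\<^sup>2) ^ (m - 1) * (2 * t)) * inverse ((1 + t\<^sup>2) ^ m)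
      = 2 * real m * t / (1 + t\<^sup>2) ^ Suc m"
    proof -
      have "inverse (J ^ m) * (real m * J ^ (m - 1) * (2 * t)) * inverse (J ^ m) = 2 * real m * t / J ^ Suc m"
        if "J \<noteq> 0" for J :: real
        using that by (cases m) (auto simp: field_simps)
      from this[of "1 + t\<^sup>2"] show ?thesis by simp
    qed
    show ?thesis using 1[unfolded 2] by (simp add: divide_inverse mult_ac)
  qed
  have dr: "(r has_real_derivative r' t) (at t)" for t
  proof -
    have "(r has_real_derivative (real j * t ^ (j - 1) / (1 + t\<^sup>2) ^ m - 2 * real m * t ^ Suc j / (1 + t\<^sup>2) ^ Suc m) * P t
        + P1 t * (2 * t / (1 + t\<^sup>2)\<^sup>2) * (t ^ j / (1 + t\<^sup>2) ^ m)) (at t)"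
      unfolding r_def[abs_def] by (rule DERIV_mult[OF quot dP])
    moreover have "(real j * a / X - 2 * real m * b / Y) * p + p1 * (2 * t / Q) * (T / X)
      = real j * (a / X * p) + (- 2 * real m) * (b / Y * p) + 2 * (t * T / (X * Q) * p1)" for a b X Y p p1 Q T :: real
      by (simp add: algebra_simps)
    ultimately show ?thesis
      unfolding r'_def power_add power_Suc by (metis DERIV_cong)
  qed
  define D where "D z h = Re (C * (of_nat n * zeta (snd z) ^ (n - 1) * zeta (snd h))) * r (fst z)
      + Re (C * zeta (snd z) ^ n) * (r' (fst z) * fst h)" for z h
  have der: "((\<lambda>z. Re (C * zeta (snd z) ^ n) * r (fst z)) has_derivative D z) (at z)" for z
  proof -
    have 1: "((\<lambda>z. zeta (snd z)) has_derivative (\<lambda>h. zeta (snd h))) (at z)"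
      by (rule bounded_linear.has_derivative[OF bounded_linear_zeta]) (auto intro: derivative_intros)
    have 2: "((\<lambda>z. Re (C * zeta (snd z) ^ n)) has_derivative
        (\<lambda>h. Re (C * (of_nat n * zeta (snd h) * zeta (snd z) ^ (n - 1))))) (at z)"
      by (intro has_derivative_Re has_derivative_mult_right has_derivative_power 1)
    have 3: "((\<lambda>z. r (fst z)) has_derivative (\<lambda>h. r' (fst z) * fst h)) (at z)"
      using has_derivative_compose[OF has_derivative_fst[OF has_derivative_ident]
          dr[unfolded has_field_derivative_def]] .
    show ?thesis
      by (rule has_derivative_eq_rhs[OF has_derivative_mult[OF 2 3]])
         (auto simp: D_def fun_eq_iff mult_ac)
  qed
  have part: "mode_function (\<lambda>z. D z b)" if "b \<in> Basis" for b
  proof -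
    from that consider "b = (1, 0)" | b' where "b = (0, b')" "b' \<in> Basis"
      by (auto simp: Basis_prod_def)
    then show ?thesis
    proof cases
      case 1
      have z0: "zeta 0 = 0" by (simp add: zeta_def complex_eq_iff)
      have c': "\<And>x::real. \<bar>x\<bar> < 1 \<Longrightarrow> summable (\<lambda>i. diffs c i * x ^ i)"
        using termdiff_converges[of _ 1 c] single by auto
      have eq: "(\<lambda>z. D z b) = (\<lambda>z.
          Re (C * complex_of_real (real j) * zeta (snd z) ^ n) * (fst z ^ (j - 1) / (1 + (fst z)\<^sup>2) ^ m * P (fst z))
        + Re (C * complex_of_real (- 2 * real m) * zeta (snd z) ^ n) * (fst z ^ Suc j / (1 + (fst z)\<^sup>2) ^ Suc m * P (fst z))
        + Re (C * complex_of_real 2 * zeta (snd z) ^ n) * (fst z ^ Suc j / (1 + (fst z)\<^sup>2) ^ (m + 2) * P1 (fst z)))"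
      proof
        fix z
        have pull: "Re (C * complex_of_real s * Z) = s * Re (C * Z)" for s Z
          by (simp add: algebra_simps)
        have "D z b = Re (C * zeta (snd z) ^ n) * r' (fst z)"
          by (simp add: D_def 1 z0)
        then show "D z b = Re (C * complex_of_real (real j) * zeta (snd z) ^ n) * (fst z ^ (j - 1) / (1 + (fst z)\<^sup>2) ^ m * P (fst z))
        + Re (C * complex_of_real (- 2 * real m) * zeta (snd z) ^ n) * (fst z ^ Suc j / (1 + (fst z)\<^sup>2) ^ Suc m * P (fst z))
        + Re (C * complex_of_real 2 * zeta (snd z) ^ n) * (fst z ^ Suc j / (1 + (fst z)\<^sup>2) ^ (m + 2) * P1 (fst z))"
          unfolding pull r'_def by (simp only: distrib_left mult_ac)
      qed
      show ?thesis
        unfolding eq P_def P1_def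
        by (intro mode_function.add mode_function.single; erule single c')
    next
      case 2
      have eq: "(\<lambda>z. D z b) = (\<lambda>z. Re (C * of_nat n * zeta b' * zeta (snd z) ^ (n - 1)) *
          (fst z ^ j / (1 + (fst z)\<^sup>2) ^ m * P (fst z)))"
        by (simp add: fun_eq_iff D_def 2 r_def mult_ac)
      show ?thesis
        unfolding eq P_def by (rule mode_function.single) (erule single)
    qed
  qed
  show ?case
    using der part unfolding r_def P_def by blast
next
  case (add f g)
  then obtain D E where
    "\<And>x. (f has_derivative D x) (at x)" "\<And>b. b \<in> Basis \<Longrightarrow> mode_function (\<lambda>x. D x b)"
    "\<And>x. (g has_derivative E x) (at x)" "\<And>b. b \<in> Basis \<Longrightarrow> mode_function (\<lambda>x. E x b)"
    by blast
  then show ?case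
    by (intro exI[of _ "\<lambda>x h. D x h + E x h"]) (auto intro: has_derivative_add mode_function.add)
qed

lemma mode_function_Ck: "mode_function g \<Longrightarrow> Ck_on k g UNIV"
  by (rule Ck_on_UNIV_if_closed_under_partials[where S = "Collect mode_function"])
     (use mode_function_partials in auto)

end

section \<open>The spherical Laplacian of a planar harmonic\<close>

context coordinate_plane
begin

lemma zeta_expand: "(\<Sum>b\<in>Basis. (x \<bullet> b) *\<^sub>R zeta b) = zeta x"
proof -
  interpret z: bounded_linear zeta by (rule bounded_linear_zeta)
  have "zeta x = zeta (\<Sum>b\<in>Basis. (x \<bullet> b) *\<^sub>R b)" by (simp add: euclidean_representation)
  then show ?thesis by (simp add: z.sum z.scaleR)
qed

text \<open>
  The form \<open>\<zeta>\<close> is isotropic, which is why every power of it is harmonic.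
\<close>

lemma zeta_isotropic: "(\<Sum>b\<in>Basis. (zeta b)\<^sup>2) = 0"
proof -
  have "(\<Sum>b\<in>Basis. (u \<bullet> b) * (v \<bullet> b)) = 0" "(\<Sum>b\<in>Basis. (u \<bullet> b) * (u \<bullet> b)) = 1"
    "(\<Sum>b\<in>Basis. (v \<bullet> b) * (v \<bullet> b)) = 1"
    unfolding euclidean_inner[symmetric] by simp_all
  then show ?thesis
    by (simp add: complex_eq_iff zeta_def power2_eq_square inner_commute sum_subtractf mult.commute sum.distrib
        flip: sum_distrib_left)
qed

text \<open>
  The second derivative, at a point of the sphere and in the direction of a unit vector \<open>b\<close>, of
  the extension \<open>C \<zeta>^n / norm^n\<close> of degree 0. Here \<open>Z\<close> and \<open>B\<close> are the values of \<open>\<zeta>\<close> at the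
  point and at \<open>b\<close>, \<open>\<beta>\<close> is the inner product of the two vectors, and \<open>\<rho>\<close> is the squared norm along the
  line. The line may meet the origin, where the extension is singular, but only at \<open>s = 1\<close> or
  \<open>s = -1\<close>.
\<close>

lemma second_derivative_homogenized_zeta_power:
  fixes \<beta> :: real and C Z B :: complex and n :: nat
  assumes \<beta>: "\<bar>\<beta>\<bar> \<le> 1"
  defines "\<rho> \<equiv> \<lambda>s. 1 + 2 * s * \<beta> + s\<^sup>2"
  shows "vector_derivative (\<lambda>s. vector_derivative
      (\<lambda>r. Re (C * (Z + r *\<^sub>R B) ^ n) * \<rho> r powr (- real n / 2)) (at s)) (at 0)
    = Re (C * of_nat n * of_nat (n - 1) * Z ^ (n - 2) * B\<^sup>2) - 2 * real n * Re (C * of_nat n * Z ^ (n - 1) * (\<beta> *\<^sub>R B))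
      + (real n * (real n + 2) * \<beta>\<^sup>2 - real n) * Re (C * Z ^ n)"
proof -
  have pos: "\<rho> s > 0" if "s \<in> {-1<..<1}" for s
  proof -
    have "\<bar>s * \<beta>\<bar> \<le> \<bar>s\<bar>" using \<beta> by (simp add: abs_mult mult_left_le)
    moreover have "(1 - \<bar>s\<bar>)\<^sup>2 > 0" using that by auto
    ultimately show ?thesis unfolding \<rho>_def by (simp add: power2_eq_square algebra_simps abs_if split: if_splits)
  qed
  have d\<rho>: "(\<rho> has_real_derivative (2 * \<beta> + 2 * s)) (at s)" for s
    unfolding \<rho>_def by (auto intro!: derivative_eq_intros)
  have dp: "((\<lambda>s. \<rho> s powr a) has_real_derivative a * \<rho> s powr (a - 1) * (2 * \<beta> + 2 * s)) (at s)"
    if "s \<in> {-1<..<1}" for s a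
    by (rule DERIV_chain2[OF has_real_derivative_powr[OF pos[OF that]] d\<rho>])
  have dz: "((\<lambda>s. Re (c * (Z + s *\<^sub>R B) ^ k)) has_real_derivative Re (c * of_nat k * (Z + s *\<^sub>R B) ^ (k - 1) * B)) (at s)"
    for s c k
  proof -
    have "((\<lambda>s. (Z + s *\<^sub>R B)) has_vector_derivative B) (at s)"
      by (auto intro!: derivative_eq_intros)
    moreover have "((\<lambda>z. c * z ^ k) has_field_derivative (c * (of_nat k * z ^ (k - 1)))) (at z)" for z
      by (auto intro!: derivative_eq_intros)
    ultimately have "(((\<lambda>z. c * z ^ k) \<circ> (\<lambda>s. Z + s *\<^sub>R B)) has_vector_derivative
        B * (c * (of_nat k * (Z + s *\<^sub>R B) ^ (k - 1)))) (at s)"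
      by (rule field_vector_diff_chain_at)
    then have "((\<lambda>s. c * (Z + s *\<^sub>R B) ^ k) has_vector_derivative
        c * of_nat k * (Z + s *\<^sub>R B) ^ (k - 1) * B) (at s)"
      by (simp add: o_def mult_ac)
    from bounded_linear.has_vector_derivative[OF bounded_linear_Re this]
    show ?thesis by (simp add: has_real_derivative_iff_has_vector_derivative)
  qed
  let ?a = "- real n / 2"
  define g1 where "g1 s = Re (C * of_nat n * B * (Z + s *\<^sub>R B) ^ (n - 1)) * \<rho> s powr ?a
      + Re (C * (Z + s *\<^sub>R B) ^ n) * (?a * \<rho> s powr (?a - 1) * (2 * \<beta> + 2 * s))" for s
  have first: "vector_derivative (\<lambda>r. Re (C * (Z + r *\<^sub>R B) ^ n) * \<rho> r powr ?a) (at s) = g1 s" if "s \<in> {-1<..<1}" for s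
    using DERIV_mult[OF dz[of C n s] dp[OF that, of ?a]]
    by (intro vector_derivative_at) (simp add: g1_def has_real_derivative_iff_has_vector_derivative mult_ac)
  have z: "(0::real) \<in> {-1<..<1}" by simp
  have lin: "((\<lambda>s. 2 * \<beta> + 2 * s) has_real_derivative 2) (at 0)"
    by (auto intro!: derivative_eq_intros)
  have rho0: "\<rho> 0 = 1" by (simp add: \<rho>_def)
  have "(g1 has_real_derivative Re (C * of_nat n * of_nat (n - 1) * Z ^ (n - 2) * B\<^sup>2)
      - 2 * real n * Re (C * of_nat n * Z ^ (n - 1) * (\<beta> *\<^sub>R B))
      + (real n * (real n + 2) * \<beta>\<^sup>2 - real n) * Re (C * Z ^ n)) (at 0)"
    unfolding g1_def[abs_def]
    by (rule DERIV_cong[OF DERIV_add[OF DERIV_mult[OF dz dp[OF z]]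
          DERIV_mult[OF dz DERIV_mult[OF DERIV_mult[OF DERIV_const dp[OF z]] lin]]]])
       (simp add: rho0 power2_eq_square field_simps numeral_2_eq_2)
  then have "((\<lambda>s. vector_derivative (\<lambda>r. Re (C * (Z + r *\<^sub>R B) ^ n) * \<rho> r powr ?a) (at s)) has_vector_derivative
      (Re (C * of_nat n * of_nat (n - 1) * Z ^ (n - 2) * B\<^sup>2)
      - 2 * real n * Re (C * of_nat n * Z ^ (n - 1) * (\<beta> *\<^sub>R B))
      + (real n * (real n + 2) * \<beta>\<^sup>2 - real n) * Re (C * Z ^ n))) (at 0)"
    unfolding has_real_derivative_iff_has_vector_derivative
    by (rule has_vector_derivative_transform_within_open[where S = "{-1<..<1}"])
       (simp, simp, erule first[symmetric])
  then show ?thesis by (rule vector_derivative_at)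
qed

text \<open>
  Summing the second derivatives over the basis, the first term drops out since \<open>\<zeta>\<close> is isotropic
  and the mixed term is evaluated by Euler's relation for the homogeneous function \<open>\<zeta>^n\<close>.
\<close>

lemma sphere_laplacian_Re_zeta_power:
  assumes \<omega>: "\<omega> \<in> sphere 0 1" and n: "n > 0"
  shows "sphere_laplacian (\<lambda>\<eta>. Re (C * zeta \<eta> ^ n)) \<omega>
    = - (real n * (real n + real DIM('a) - 2)) * Re (C * zeta \<omega> ^ n)"
proof -
  interpret z: bounded_linear zeta by (rule bounded_linear_zeta)
  have nw: "norm \<omega> = 1" using \<omega> by simp
  let ?Z = "zeta \<omega>"
  have *: "Re (C * zeta (sgn (\<omega> + r *\<^sub>R b)) ^ n)
      = Re (C * (?Z + r *\<^sub>R zeta b) ^ n) * (1 + 2 * r * (\<omega> \<bullet> b) + r\<^sup>2) powr (- real n / 2)"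
    if b: "b \<in> Basis" for r b
  proof (cases "\<omega> + r *\<^sub>R b = 0")
    case True
    then have "zeta (\<omega> + r *\<^sub>R b) = 0" by (simp add: z.zero)
    then have "?Z + r *\<^sub>R zeta b = 0" by (simp add: z.add z.scaleR)
    then show ?thesis using n True by (simp add: z.zero power_0_left)
  next
    case False
    have "\<omega> \<bullet> \<omega> = 1" "b \<bullet> b = 1" using nw b by (simp_all add: norm_eq_1)
    then have "(norm (\<omega> + r *\<^sub>R b))\<^sup>2 = 1 + 2 * r * (\<omega> \<bullet> b) + r\<^sup>2"
      unfolding power2_norm_eq_inner
      by (simp add: inner_add_left inner_add_right inner_commute[of b \<omega>] power2_eq_square algebra_simps)
    moreover have "x\<^sup>2 powr (- real n / 2) = inverse (x ^ n)" if "x > 0" for x :: real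
    proof -
      have "x\<^sup>2 = x powr 2" using that by simp
      then have "x\<^sup>2 powr (- real n / 2) = x powr (- real n)" by (simp only: powr_powr) simp
      then show ?thesis using that by (simp add: powr_minus powr_realpow)
    qed
    ultimately have p: "(1 + 2 * r * (\<omega> \<bullet> b) + r\<^sup>2) powr (- real n / 2) = inverse (norm (\<omega> + r *\<^sub>R b) ^ n)"
      using False by (metis zero_less_norm_iff)
    have "zeta (sgn (\<omega> + r *\<^sub>R b)) = (?Z + r *\<^sub>R zeta b) /\<^sub>R norm (\<omega> + r *\<^sub>R b)"
      by (simp add: sgn_div_norm z.scaleR z.add)
    then have "zeta (sgn (\<omega> + r *\<^sub>R b)) ^ n = inverse (norm (\<omega> + r *\<^sub>R b) ^ n) *\<^sub>R (?Z + r *\<^sub>R zeta b) ^ n"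
      by (simp add: scaleR_power power_inverse)
    then show ?thesis unfolding p by simp
  qed
  have "sphere_laplacian (\<lambda>\<eta>. Re (C * zeta \<eta> ^ n)) \<omega> =
      (\<Sum>b\<in>Basis. Re (C * of_nat n * of_nat (n - 1) * ?Z ^ (n - 2) * (zeta b)\<^sup>2)
        - 2 * real n * Re (C * of_nat n * ?Z ^ (n - 1) * ((\<omega> \<bullet> b) *\<^sub>R zeta b))
        + (real n * (real n + 2) * (\<omega> \<bullet> b)\<^sup>2 - real n) * Re (C * ?Z ^ n))"
    unfolding sphere_laplacian_def laplacian_def
  proof (rule sum.cong[OF refl])
    fix b :: 'a assume b: "b \<in> Basis"
    have "\<bar>\<omega> \<bullet> b\<bar> \<le> 1" using Basis_le_norm[OF b, of \<omega>] nw by simp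
    from second_derivative_homogenized_zeta_power[OF this, of C ?Z "zeta b" n]
    show "vector_derivative (\<lambda>s. vector_derivative (\<lambda>r. Re (C * zeta (sgn (\<omega> + r *\<^sub>R b)) ^ n)) (at s)) (at 0)
      = Re (C * of_nat n * of_nat (n - 1) * ?Z ^ (n - 2) * (zeta b)\<^sup>2)
        - 2 * real n * Re (C * of_nat n * ?Z ^ (n - 1) * ((\<omega> \<bullet> b) *\<^sub>R zeta b))
        + (real n * (real n + 2) * (\<omega> \<bullet> b)\<^sup>2 - real n) * Re (C * ?Z ^ n)"
      unfolding *[OF b] .
  qed
  also have "\<dots> = Re (C * of_nat n * of_nat (n - 1) * ?Z ^ (n - 2) * (\<Sum>b\<in>Basis. (zeta b)\<^sup>2))
      - 2 * real n * Re (C * of_nat n * ?Z ^ (n - 1) * (\<Sum>b\<in>Basis. (\<omega> \<bullet> b) *\<^sub>R zeta b))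
      + (real n * (real n + 2) * (\<Sum>b\<in>Basis. (\<omega> \<bullet> b)\<^sup>2) - real n * real DIM('a)) * Re (C * ?Z ^ n)"
    by (simp only: sum.distrib sum_subtractf Re_sum sum_distrib_left sum_distrib_right left_diff_distrib
        sum_constant) (simp add: sum_distrib_left sum_distrib_right)
  also have "(\<Sum>b\<in>Basis. (\<omega> \<bullet> b)\<^sup>2) = 1"
    using nw by (simp add: norm_eq_sqrt_inner euclidean_inner[of \<omega> \<omega>] power2_eq_square)
  also have "C * of_nat n * ?Z ^ (n - 1) * (\<Sum>b\<in>Basis. (\<omega> \<bullet> b) *\<^sub>R zeta b) = C * of_nat n * ?Z ^ n"
    unfolding zeta_expand using n by (cases n) auto
  also have "Re (C * of_nat n * of_nat (n - 1) * ?Z ^ (n - 2) * (\<Sum>b\<in>Basis. (zeta b)\<^sup>2))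
      - 2 * real n * Re (C * of_nat n * ?Z ^ n) + (real n * (real n + 2) * 1 - real n * real DIM('a)) * Re (C * ?Z ^ n)
     = - (real n * (real n + real DIM('a) - 2)) * Re (C * ?Z ^ n)"
    by (simp add: zeta_isotropic algebra_simps)
  finally show ?thesis .
qed

end

section \<open>The growing mode solves the linearised equation\<close>

lemma bracket_pos [simp]: "bracket t > 0" "bracket t \<noteq> 0"
  unfolding bracket_def by simp_all

lemma bracket_sq: "(bracket t)\<^sup>2 = 1 + t\<^sup>2"
  unfolding bracket_def by (simp add: add_nonneg_nonneg)

lemma DERIV_bracket: "(bracket has_real_derivative t / bracket t) (at t)"
proof -
  have "((\<lambda>t. 1 + t\<^sup>2) has_real_derivative 2 * t) (at t)"
    by (auto intro!: derivative_eq_intros)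
  from DERIV_chain2[OF DERIV_real_sqrt[OF one_plus_square_pos(1)] this]
  have "(bracket has_real_derivative inverse (bracket t) / 2 * (2 * t)) (at t)"
    unfolding bracket_def[abs_def] .
  then show ?thesis by (rule DERIV_cong) (simp add: inverse_eq_divide)
qed

lemma half_notin_Ints: "(1/2 :: real) \<notin> \<int>"
proof
  assume "(1/2 :: real) \<in> \<int>"
  then obtain k :: int where "(1/2 :: real) = of_int k" by (auto elim: Ints_cases)
  then have "1 = 2 * k" by linarith
  then show False by presburger
qed

context coordinate_plane
begin

lemma DIM_ge_2: "2 \<le> DIM('a)"
proof -
  have "card {u, v} \<le> DIM('a)" using u v by (intro card_mono) auto
  then show ?thesis using uv by simp
qed

text \<open>
  The parameters are \<open>- (n + d) / 2\<close>, \<open>(n - 1) / 2\<close> and \<open>1/2\<close> for the degree \<open>n = 2 q + 1\<close> and the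
  dimension \<open>d = DIM('a) - 1\<close> of the sphere.
\<close>

definition profile_coeff :: "nat \<Rightarrow> nat \<Rightarrow> real" where
  "profile_coeff q = hyp2F1_coeff (- (real q + real DIM('a) / 2)) (real q) (1/2)"

definition profile :: "nat \<Rightarrow> real \<Rightarrow> real" where
  "profile q x = (\<Sum>i. profile_coeff q i * x ^ i)"

definition growing_mode :: "nat \<Rightarrow> real \<times> 'a \<Rightarrow> real" where
  "growing_mode q z = Re (zeta (snd z) ^ (2 * q + 1)) * (profile q (compactified_time (fst z)) / (1 + (fst z)\<^sup>2) ^ q)"

text \<open>
  The margin equals \<open>1 + d / 2\<close>, independently of the degree.
\<close>

lemma profile_margin: "1/2 - (- (real q + real DIM('a) / 2)) - real q > 1"
  using DIM_ge_2 by simp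

lemma summable_profile: "\<bar>x\<bar> < 1 \<Longrightarrow> summable (\<lambda>i. profile_coeff q i * x ^ i)"
  unfolding profile_coeff_def by (rule summable_hyp2F1(1)[OF half_notin_Ints profile_margin]) simp

lemma growing_mode_Ck: "Ck_on k (growing_mode q) UNIV"
proof -
  have "growing_mode q = (\<lambda>z. Re (1 * zeta (snd z) ^ (2 * q + 1)) *
      (fst z ^ 0 / (1 + (fst z)\<^sup>2) ^ q * (\<Sum>i. profile_coeff q i * compactified_time (fst z) ^ i)))"
    by (simp add: fun_eq_iff growing_mode_def profile_def)
  moreover have "mode_function \<dots>"
    by (rule mode_function.single) (erule summable_profile)
  ultimately show ?thesis by (simp add: mode_function_Ck)
qed

lemma growing_mode_dS_point:
  "growing_mode q (dS_point t \<eta>) = bracket t * profile q (compactified_time t) * Re (zeta \<eta> ^ (2 * q + 1))"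
proof -
  interpret z: bounded_linear zeta by (rule bounded_linear_zeta)
  have "zeta (bracket t *\<^sub>R \<eta>) ^ (2 * q + 1) = bracket t ^ (2 * q + 1) *\<^sub>R zeta \<eta> ^ (2 * q + 1)"
    by (simp only: z.scaleR scaleR_power)
  moreover have "bracket t ^ (2 * q + 1) = bracket t * (1 + t\<^sup>2) ^ q"
    by (simp add: power_mult bracket_sq)
  ultimately show ?thesis by (simp add: growing_mode_def dS_point_def)
qed

text \<open>
  With \<open>1 - w = 1 / (1 + t\<^sup>2)\<close> the equation for the factor depending on \<open>t\<close> is \<open>4 (1 - w)\<close> times the
  hypergeometric equation at \<open>w\<close>.
\<close>

lemma growing_mode_solves:
  assumes \<omega>: "\<omega> \<in> sphere 0 1"
  shows "dS_box (growing_mode q) t \<omega> + real DIM('a) * growing_mode q (dS_point t \<omega>) = 0"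
proof -
  define d where "d = DIM('a) - 1"
  have d: "real DIM('a) = real d + 1" "d \<ge> 1" using DIM_ge_2 by (auto simp: d_def)
  define n where "n = 2 * q + 1"
  define y where "y = Re (zeta \<omega> ^ n)"
  define F where "F s = profile q (compactified_time s)" for s
  define F1 where "F1 s = (\<Sum>i. diffs (profile_coeff q) i * compactified_time s ^ i)" for s
  define F2 where "F2 s = (\<Sum>i. diffs (diffs (profile_coeff q)) i * compactified_time s ^ i)" for s
  let ?J = "\<lambda>s. 1 + s\<^sup>2 :: real"
  have sum1: "\<And>x::real. \<bar>x\<bar> < 1 \<Longrightarrow> summable (\<lambda>i. diffs (profile_coeff q) i * x ^ i)"
    using termdiff_converges[of _ 1 "profile_coeff q"] summable_profile by auto
  have dF: "(F has_real_derivative F1 s * (2 * s / (?J s)\<^sup>2)) (at s)" for s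
    unfolding F_def[abs_def] F1_def profile_def
    by (rule DERIV_power_series_compactified_time) (erule summable_profile)
  have dF1: "(F1 has_real_derivative F2 s * (2 * s / (?J s)\<^sup>2)) (at s)" for s
    unfolding F1_def[abs_def] F2_def
    by (rule DERIV_power_series_compactified_time) (erule sum1)
  have ode: "compactified_time t * (1 - compactified_time t) * F2 t
      + (1/2 + (real d - 1) / 2 * compactified_time t) * F1 t
    = - (real q + real DIM('a) / 2) * real q * F t"
    using hyp2F1_ode[OF half_notin_Ints profile_margin compactified_time_bounds(3)[of t], of q] d
    unfolding F_def F1_def F2_def profile_def profile_coeff_def
    by (simp add: field_simps)
  have on_sphere: "growing_mode q (dS_point s \<omega>) = bracket s * F s * y" for s
    by (simp add: growing_mode_dS_point F_def y_def n_def)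
  have du: "((\<lambda>r. bracket r * F r * y) has_real_derivative
      (s * F s + 2 * s * F1 s / ?J s) * y / bracket s) (at s)" for s
  proof -
    have 1: "((\<lambda>r. bracket r * F r * y) has_real_derivative
        (s / bracket s * F s + F1 s * (2 * s / (?J s)\<^sup>2) * bracket s) * y) (at s)"
      by (rule DERIV_cmult_right[OF DERIV_mult[OF DERIV_bracket dF]])
    have 2: "F1 s * (2 * s / (?J s)\<^sup>2) * bracket s = 2 * s * F1 s / ?J s / bracket s"
      unfolding bracket_sq[symmetric] by (simp add: power2_eq_square mult_ac)
    have 3: "(s / b * f + x / b) * y = (s * f + x) * y / b" for b f x :: real
      by (simp add: add_divide_distrib distrib_right)
    show ?thesis using 1 unfolding 2 3 .
  qed
  have inner: "bracket s ^ (d + 1) * deriv (\<lambda>r. growing_mode q (dS_point r \<omega>)) s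
      = bracket s ^ d * ((s * F s + 2 * s * F1 s / ?J s) * y)" for s
    unfolding on_sphere DERIV_imp_deriv[OF du] by simp
  have dbr: "((\<lambda>s. bracket s ^ d) has_real_derivative real d * t * bracket t ^ d / ?J t) (at t)"
  proof -
    have 1: "((\<lambda>s. bracket s ^ d) has_real_derivative real d * (t / bracket t * bracket t ^ (d - Suc 0))) (at t)"
      by (rule DERIV_power[OF DERIV_bracket])
    have 2: "t / bracket t * bracket t ^ (d - Suc 0) = t * bracket t ^ d / ?J t"
      unfolding bracket_sq[symmetric] using d(2) by (cases d) (auto simp: power2_eq_square)
    show ?thesis using 1 unfolding 2 by (simp add: mult_ac)
  qed
  let ?E = "real d * t / ?J t * (t * F t + 2 * t * F1 t / ?J t)
      + (F t + t * (F1 t * (2 * t / (?J t)\<^sup>2)) + (2 * F1 t + 2 * t * (F2 t * (2 * t / (?J t)\<^sup>2))) / ?J t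
         - 2 * t * F1 t * (2 * t) / (?J t)\<^sup>2)"
  have "((\<lambda>s. bracket s ^ d * ((s * F s + 2 * s * F1 s / ?J s) * y)) has_real_derivative bracket t ^ d * (?E * y)) (at t)"
  proof -
    have J: "(?J has_real_derivative 2 * t) (at t)"
      by (auto intro!: derivative_eq_intros)
    have l: "((\<lambda>s. 2 * s) has_real_derivative 2) (at t)" by (auto intro!: derivative_eq_intros)
    have quot: "((\<lambda>s. 2 * s * F1 s / ?J s) has_real_derivative
        (2 * F1 t + 2 * t * (F2 t * (2 * t / (?J t)\<^sup>2))) / ?J t - 2 * t * F1 t * (2 * t) / (?J t)\<^sup>2) (at t)"
    proof (rule DERIV_cong[OF DERIV_divide[OF DERIV_mult[OF l dF1] J]])
      have "((2 * F1 t + f * (2 * t)) * J - 2 * t * F1 t * (2 * t)) / (J * J)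
          = (2 * F1 t + 2 * t * f) / J - 2 * t * F1 t * (2 * t) / J\<^sup>2" if "J \<noteq> 0" for f J :: real
        using that by (simp add: power2_eq_square diff_divide_distrib mult_ac)
      from this[of "?J t" "F2 t * (2 * t / (?J t)\<^sup>2)"]
      show "((2 * F1 t + F2 t * (2 * t / (?J t)\<^sup>2) * (2 * t)) * ?J t - 2 * t * F1 t * (2 * t)) / (?J t * ?J t)
          = (2 * F1 t + 2 * t * (F2 t * (2 * t / (?J t)\<^sup>2))) / ?J t - 2 * t * F1 t * (2 * t) / (?J t)\<^sup>2"
        by simp
    qed simp
    have "real d * t * B / J * (x * y) + (1 * F t + p + r) * y * B = B * ((real d * t / J * x + (F t + p' + r)) * y)"
      if "p = p'" for B J x p p' r :: real
      using that by (simp add: algebra_simps)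
    then show ?thesis
      by (intro DERIV_cong[OF DERIV_mult[OF dbr DERIV_cmult_right[OF DERIV_add[OF
            DERIV_mult[OF DERIV_ident dF] quot]]]])
         (simp only: add_diff_eq[symmetric] add.assoc[symmetric] mult.commute[of t])
  qed
  then have outer: "deriv (\<lambda>s. bracket s ^ (d + 1) * deriv (\<lambda>r. growing_mode q (dS_point r \<omega>)) s) t = bracket t ^ d * (?E * y)"
    unfolding inner by (rule DERIV_imp_deriv)
  have pull: "Re (complex_of_real a * w) = a * Re w" for a w by simp
  have lap: "sphere_laplacian (\<lambda>\<eta>. growing_mode q (dS_point t \<eta>)) \<omega>
      = - (real n * (real n + real d - 1)) * (bracket t * F t * y)"
    unfolding growing_mode_dS_point pull[symmetric]
    by (subst sphere_laplacian_Re_zeta_power[OF \<omega>])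
       (use d in \<open>simp_all add: F_def y_def n_def\<close>)
  have p1: "bracket t powi (- (int d - 1)) * bracket t ^ d = bracket t"
    using d(2) by (cases d) (auto simp: power_int_minus)
  have p2: "bracket t powi (-2) * bracket t = bracket t / ?J t"
    unfolding bracket_sq[symmetric] by (simp add: power_int_minus field_simps power2_eq_square)
  have "dS_box (growing_mode q) t \<omega> = - (bracket t * ?E * y) - real n * (real n + real d - 1) * (bracket t / ?J t) * F t * y"
  proof -
    have "dS_box (growing_mode q) t \<omega> =
      - (bracket t powi (- (int d - 1)) * (bracket t ^ d * (?E * y)))
      + bracket t powi (-2) * (- (real n * (real n + real d - 1)) * (bracket t * F t * y))"
      unfolding dS_box_def Let_def d_def[symmetric] outer lap ..
    also have "\<dots> = - (bracket t powi (- (int d - 1)) * bracket t ^ d) * (?E * y)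
      - real n * (real n + real d - 1) * (bracket t powi (-2) * bracket t) * F t * y"
      by (simp add: mult_ac)
    finally show ?thesis unfolding p1 p2 by simp
  qed
  moreover have "?E + real n * (real n + real d - 1) / ?J t * F t = (real d + 1) * F t"
  proof -
    \<comment> \<open>The number \<open>i\<close> is \<open>1 - w\<close>, and in terms of \<open>i\<close> the claim is polynomial.\<close>
    define i where "i = 1 / ?J t"
    have ti: "t\<^sup>2 * i = 1 - i" by (simp add: i_def field_simps)
    have w: "compactified_time t = 1 - i" by (simp add: compactified_time_def i_def field_simps)
    have "(1 - i) * i * F2 t + (1/2 + (real d - 1) / 2 * (1 - i)) * F1 t + (real q + (real d + 1) / 2) * real q * F t = 0"
      using ode unfolding w d(1) by (simp only: mult_minus_left diff_diff_eq2 add_diff_cancel_left' add.left_inverse)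
    then have E1: "i * (4 * ((1 - i) * i * F2 t) + (2 + 2 * (real d - 1) * (1 - i)) * F1 t
        + (2 * real q + real d + 1) * (2 * real q) * F t) = 0"
      by (simp add: field_simps)
    have E2: "?E = real d * (t\<^sup>2 * i) * F t + 2 * real d * (t\<^sup>2 * i) * i * F1 t
        + F t + 2 * (t\<^sup>2 * i) * i * F1 t + 2 * i * F1 t + 4 * (t\<^sup>2 * i) * i * i * F2 t - 4 * (t\<^sup>2 * i) * i * F1 t"
    proof -
      have "real d * t / J * (t * f + 2 * t * f1 / J)
          + (f + t * (f1 * (2 * t / J\<^sup>2)) + (2 * f1 + 2 * t * (f2 * (2 * t / J\<^sup>2))) / J
             - 2 * t * f1 * (2 * t) / J\<^sup>2)
        = real d * (t\<^sup>2 * (1 / J)) * f + 2 * real d * (t\<^sup>2 * (1 / J)) * (1 / J) * f1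
          + f + 2 * (t\<^sup>2 * (1 / J)) * (1 / J) * f1 + 2 * (1 / J) * f1
          + 4 * (t\<^sup>2 * (1 / J)) * (1 / J) * (1 / J) * f2 - 4 * (t\<^sup>2 * (1 / J)) * (1 / J) * f1" for f f1 f2 J :: real
        by (simp add: power2_eq_square add_divide_distrib ring_distribs mult_ac)
      then show ?thesis unfolding i_def .
    qed
    have E3: "real n * (real n + real d - 1) / ?J t * F t = (2 * real q + 1) * (2 * real q + real d) * i * F t"
      by (simp add: n_def i_def)
    show ?thesis unfolding E2 E3 ti using E1 by (simp add: algebra_simps)
  qed
  moreover have "- (b * e * y) - k * (b / J) * f * y + m * (b * f * y) = b * y * (m * f - (e + k / J * f))"
    for b e k J f m :: real
    by (simp add: algebra_simps)
  ultimately show ?thesis unfolding on_sphere d by simp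
qed

end

section \<open>Growth and orthogonality of the growing mode\<close>

lemma tendsto_compactified_time: "(compactified_time \<longlongrightarrow> 1) at_top"
  unfolding compactified_time_def by real_asymp

context coordinate_plane
begin

lemma profile_at_1_nonzero: "profile q 1 \<noteq> 0"
  using hyp2F1_at_1_nonzero[OF half_notin_Ints profile_margin[of q]]
  by (simp add: profile_def profile_coeff_def)

lemma tendsto_profile_compactified_time:
  "((\<lambda>t. profile q (compactified_time t)) \<longlongrightarrow> profile q 1) at_top"
proof -
  have "continuous_on {0..1} (profile q)"
    unfolding profile_def[abs_def] profile_coeff_def
    by (rule continuous_on_hyp2F1[OF half_notin_Ints profile_margin])
  then show ?thesis
    by (rule continuous_on_tendsto_compose[OF _ tendsto_compactified_time])
       (auto intro!: always_eventually compactified_time_bounds less_imp_le)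
qed

text \<open>
  On the set where \<open>Re (\<zeta>^n) > 1/2\<close> the solution is eventually larger than \<open>t \<bar>F(1)\<bar> / 4\<close>. The set is
  relatively open in the sphere and contains the basis vector \<open>u\<close>, so it is not a null set.
\<close>

lemma growing_mode_esssup:
  "\<exists>c>0. \<forall>\<^sub>F t in at_top.
     ereal (c * t) \<le> esssup sphere_measure (\<lambda>\<omega>. ereal \<bar>growing_mode q (dS_point t \<omega>)\<bar>)"
proof -
  define K where "K = \<bar>profile q 1\<bar> / 2"
  have K: "K > 0" using profile_at_1_nonzero by (simp add: K_def)
  define U where "U = {x. Re (zeta x ^ (2 * q + 1)) > 1/2}"
  have U: "open U"
    unfolding U_def by (intro open_Collect_less continuous_intros continuous_on_zeta)
  have "zeta u = 1" by (simp add: zeta_def complex_eq_iff)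
  then have "u \<in> U" "norm u = 1" using u by (simp_all add: U_def)
  then have pos: "emeasure sphere_measure (U \<inter> sphere 0 1) \<noteq> 0"
    by (rule sphere_measure_open_pos[OF U])
  have "((\<lambda>t. \<bar>profile q (compactified_time t)\<bar>) \<longlongrightarrow> \<bar>profile q 1\<bar>) at_top"
    by (intro tendsto_intros tendsto_profile_compactified_time)
  then have "\<forall>\<^sub>F t in at_top. \<bar>profile q (compactified_time t)\<bar> > K"
    by (rule order_tendstoD) (use K in \<open>simp add: K_def\<close>)
  then have "\<forall>\<^sub>F t in at_top.
     ereal (K / 2 * t) \<le> esssup sphere_measure (\<lambda>\<omega>. ereal \<bar>growing_mode q (dS_point t \<omega>)\<bar>)"
    using eventually_gt_at_top[of 0]
  proof eventually_elim
    case (elim t)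
    let ?f = "\<lambda>\<omega>. ereal \<bar>growing_mode q (dS_point t \<omega>)\<bar>"
    have large: "ereal (K / 2 * t) \<le> ?f \<omega>" if "\<omega> \<in> U" for \<omega>
    proof -
      have "t \<le> bracket t"
        unfolding bracket_def by (rule real_le_rsqrt) simp
      moreover have "1/2 \<le> \<bar>Re (zeta \<omega> ^ (2 * q + 1))\<bar>" using that by (simp add: U_def)
      ultimately have "t * K * (1/2) \<le> bracket t * \<bar>profile q (compactified_time t)\<bar> * \<bar>Re (zeta \<omega> ^ (2 * q + 1))\<bar>"
        using elim K by (intro mult_mono) auto
      moreover have "\<bar>growing_mode q (dS_point t \<omega>)\<bar> = bracket t * \<bar>profile q (compactified_time t)\<bar> * \<bar>Re (zeta \<omega> ^ (2 * q + 1))\<bar>"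
        by (simp only: growing_mode_dS_point abs_mult abs_of_pos[OF bracket_pos(1)])
      ultimately show ?thesis by (simp add: mult.commute)
    qed
    show ?case
    proof (rule ccontr)
      assume "\<not> ?case"
      then have less: "esssup sphere_measure ?f < ereal (K / 2 * t)" by simp
      have avoid: "AE \<omega> in sphere_measure. \<omega> \<notin> U"
        using esssup_AE[of ?f sphere_measure]
      proof eventually_elim
        case (elim \<omega>)
        show ?case
        proof
          assume "\<omega> \<in> U"
          from order_trans[OF large[OF this] elim] show False using less leD by blast
        qed
      qed
      have trace: "{\<omega> \<in> space sphere_measure. \<not> \<omega> \<notin> U} = U \<inter> sphere 0 1" by auto
      have meas: "U \<inter> sphere 0 1 \<in> sets sphere_measure"
        using U by (auto simp: sets_restrict_space_iff)
      show False using AE_iff_measurable[OF meas trace] avoid pos by blast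
    qed
  qed
  then show ?thesis using K by (intro exI[of _ "K / 2"]) auto
qed

lemma growing_mode_orthogonal:
  assumes "(LINT \<omega>|sphere_measure. complex_of_real (Re (zeta \<omega> ^ (2 * q + 1))) * Z \<omega>) = 0"
  shows "(LINT \<omega>|sphere_measure. complex_of_real (growing_mode q (dS_point t \<omega>)) * Z \<omega>) = 0"
proof -
  have "complex_of_real (growing_mode q (dS_point t \<omega>)) * Z \<omega> =
      complex_of_real (bracket t * profile q (compactified_time t)) *
      (complex_of_real (Re (zeta \<omega> ^ (2 * q + 1))) * Z \<omega>)" for \<omega>
    by (simp only: growing_mode_dS_point of_real_mult mult.assoc)
  then show ?thesis using assms by (simp only: integral_mult_right_zero mult_zero_right)
qed

text \<open>
  A spherical harmonic is the restriction of a polynomial, and the degree of the growing mode can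
  be taken as large as the frequencies of that polynomial require.
\<close>

lemma eventually_orthogonal_spherical_harmonic:
  assumes "spherical_harmonic l Z"
  shows "\<exists>N. \<forall>n\<ge>N. (LINT \<omega>|sphere_measure. complex_of_real (Re (zeta \<omega> ^ n)) * Z \<omega>) = 0"
proof -
  obtain p where p: "polynomial_function p" "\<And>\<omega>. \<omega> \<in> sphere 0 1 \<Longrightarrow> Z \<omega> = p \<omega>"
    using assms unfolding spherical_harmonic_def by blast
  have "(LINT \<omega>|sphere_measure. complex_of_real (Re (zeta \<omega> ^ n)) * Z \<omega>)
      = (LINT \<omega>|sphere_measure. complex_of_real (Re (zeta \<omega> ^ n)) * p \<omega>)" for n
    by (rule Bochner_Integration.integral_cong) (use p(2) in auto)
  then show ?thesis using eventually_orthogonal_Re_zeta_power[OF p(1)] by simp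
qed

end

section \<open>Solutions that avoid a finite set of harmonics\<close>

theorem theorem3p5:
  fixes d :: nat
    and M :: "nat \<Rightarrow> 'm set"
    and Y :: "'m \<Rightarrow> nat \<Rightarrow> 'a::euclidean_space \<Rightarrow> complex"
    and A :: "('m \<times> nat) set"
  assumes "d \<ge> 1" and "DIM('a) = d + 1"
    and "spherical_harmonic_basis M Y"
    and "finite A" and "\<And>m l. (m, l) \<in> A \<Longrightarrow> m \<in> M l"
  shows "\<exists>\<phi> :: real \<times> 'a \<Rightarrow> real.
    smooth_on_submanifold \<phi> de_sitter \<and>
    (\<forall>t. \<forall>\<omega>\<in>sphere 0 1. dS_box \<phi> t \<omega> + (real d + 1) * \<phi> (dS_point t \<omega>) = 0) \<and>
    (\<exists>c>0. \<forall>\<^sub>F t in at_top.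
       ereal (c * t) \<le> esssup sphere_measure (\<lambda>\<omega>. ereal \<bar>\<phi> (dS_point t \<omega>)\<bar>)) \<and>
    (\<forall>(m, l)\<in>A. \<forall>t.
       (LINT \<omega>|sphere_measure. complex_of_real (\<phi> (dS_point t \<omega>)) * Y m l \<omega>) = 0)"
proof -
  have "\<not> card (Basis :: 'a set) \<le> Suc 0" using assms(1,2) by simp
  then obtain u v :: 'a where "u \<in> Basis" "v \<in> Basis" "u \<noteq> v"
    by (auto simp: card_le_Suc0_iff_eq)
  then interpret coordinate_plane u v by unfold_locales
  have "\<exists>N. \<forall>n\<ge>N. (LINT \<omega>|sphere_measure. complex_of_real (Re (zeta \<omega> ^ n)) * Y (fst x) (snd x) \<omega>) = 0"
    if "x \<in> A" for x
  proof (rule eventually_orthogonal_spherical_harmonic)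
    show "spherical_harmonic (snd x) (Y (fst x) (snd x))"
      using that assms(3,5) unfolding spherical_harmonic_basis_def by (metis prod.collapse)
  qed
  then obtain N where N: "\<And>x n. x \<in> A \<Longrightarrow> n \<ge> N x \<Longrightarrow>
      (LINT \<omega>|sphere_measure. complex_of_real (Re (zeta \<omega> ^ n)) * Y (fst x) (snd x) \<omega>) = 0"
    by metis
  \<comment> \<open>The sum serves as an upper bound for all \<open>N x\<close>.\<close>
  define q where "q = (\<Sum>x\<in>A. N x)"
  have q: "N x \<le> 2 * q + 1" if "x \<in> A" for x
    using member_le_sum[OF that _ assms(4), of N] by (simp add: q_def)
  have "smooth_on_submanifold (growing_mode q) de_sitter"
    unfolding smooth_on_submanifold_def using growing_mode_Ck by blast
  moreover have "dS_box (growing_mode q) t \<omega> + (real d + 1) * growing_mode q (dS_point t \<omega>) = 0"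
    if "\<omega> \<in> sphere 0 1" for t \<omega>
    using growing_mode_solves[OF that, of q t] assms(2) by (simp add: add.commute)
  moreover have "(LINT \<omega>|sphere_measure. complex_of_real (growing_mode q (dS_point t \<omega>)) * Y m l \<omega>) = 0"
    if "(m, l) \<in> A" for m l t
    using growing_mode_orthogonal[OF N[OF that q[OF that]]] by simp
  ultimately show ?thesis
    using growing_mode_esssup by (intro exI[of _ "growing_mode q"]) blast
qed

end
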